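(* Let $G$ be a countable discrete group, $K\le G$ a subgroup of finite index, $A$ a separable C$^*$-algebra and $\beta:G\to\mathrm{Aut}(A)$ an action with multiplier Rokhlin dimension at most $d$ with respect to $K$. Then $\beta$ has Rokhlin dimension at most $d$ with respect to $K$. Moreover, if $\beta$ has multiplier Rokhlin dimension at most $d$ with commuting towers with respect to $K$, then $\beta$ has Rokhlin dimension at most $d$ with commuting towers with respect to $K$.
   Context: $G/K$ denotes the set of left cosets $\overline g=gK$, and $\overline{hg}=hgK$. $\mathcal M(A)$ is the multiplier algebra and $\mathcal M(\beta)$ the induced action on it. Multiplier Rokhlin dimension with respect to $K$: the least $d$ such that for every $\epsilon>0$ and finite $M\subset G$, $F\subset A$ there are positive contractions $(f^{(l)}_{\overline g})_{l=0,\dots,d;\overline g\in G/K}\subset\mathcal M(A)$ with (i) $\|f^{(l)}_{\overline g}f^{(l)}_{\overline h}\|<\epsilon$ for $\overline g\neq\overline h$; (ii) $\|\sum_{l}\sum_{\overline g}f^{(l)}_{\overline g}-1\|<\epsilon$; (iii) $\|\mathcal M(\beta_h)(f^{(l)}_{\overline g})-f^{(l)}_{\overline{hg}}\|<\epsilon$ for $h\in M$; (iv) $\|[f^{(l)}_{\overline g},a]\|<\epsilon$ for $a\in F$; with commuting towers if additionally (v) $\|[f^{(l)}_{\overline g},f^{(k)}_{\overline h}]\|<\epsilon$ for all $k,l,\overline g,\overline h$. Rokhlin dimension with respect to $K$ (Szabó–Wu–Zacharias, in its equivalent local form): the least $d$ such that for every finite $M\subset G$, $F\subset A$ and $\epsilon>0$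 there are positive contractions $(f^{(l)}_{\overline g})_{l=0..d,\overline g\in G/K}\subset A$ with (a) $\|(\sum_{l,\overline g}f^{(l)}_{\overline g})a-a\|<\epsilon$; (b) $\|f^{(l)}_{\overline g}f^{(l)}_{\overline h}a\|\le\epsilon$ for $\overline g\ne\overline h$; (c) $\|(\beta_g(f^{(l)}_{\overline h})-f^{(l)}_{\overline{gh}})a\|<\epsilon$ for $g\in M$; (d) $\|[f^{(l)}_{\overline g},a]\|<\epsilon$, all for $a\in F$; with commuting towers if also (e) $\|(f^{(k)}_{\overline g}f^{(l)}_{\overline h}-f^{(l)}_{\overline h}f^{(k)}_{\overline g})a\|<\epsilon$ for all $a\in F$, $k,l$, $\overline g,\overline h$. *)

theory Defs
  imports "HOL-Analysis.Analysis" "HOL-Algebra.Coset"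
begin

class cstar_algebra = real_normed_algebra + banach +
  fixes cscale :: "complex \<Rightarrow> 'a \<Rightarrow> 'a"
    and adj :: "'a \<Rightarrow> 'a"
  assumes cscale_add_left: "cscale (a + b) x = cscale a x + cscale b x"
    and cscale_add_right: "cscale a (x + y) = cscale a x + cscale a y"
    and cscale_cscale: "cscale a (cscale b x) = cscale (a * b) x"
    and cscale_of_real: "cscale (complex_of_real r) x = scaleR r x"
    and norm_cscale: "norm (cscale a x) = cmod a * norm x"
    and cscale_mult_left: "cscale a (x * y) = cscale a x * y"
    and cscale_mult_right: "cscale a (x * y) = x * cscale a y"
    and adj_adj: "adj (adj x) = x"
    and adj_add: "adj (x + y) = adj x + adj y"
    and adj_cscale: "adj (cscale a x) = cscale (cnj a) (adj x)"
    and adj_mult: "adj (x * y) = adj y * adj x"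
    and cstar_identity: "norm (adj x * x) = (norm x)\<^sup>2"

definition separable_cstar :: "'a::cstar_algebra itself \<Rightarrow> bool" where
  "separable_cstar _ \<longleftrightarrow> (\<exists>D::'a set. countable D \<and> closure D = UNIV)"

definition positive_contraction :: "'a::cstar_algebra \<Rightarrow> bool" where
  "positive_contraction x \<longleftrightarrow> (\<exists>y. x = adj y * y) \<and> norm x \<le> 1"

definition star_automorphism :: "('a::cstar_algebra \<Rightarrow> 'a) \<Rightarrow> bool" where
  "star_automorphism \<phi> \<longleftrightarrow> bij \<phi> \<and>
     (\<forall>x y. \<phi> (x + y) = \<phi> x + \<phi> y) \<and>
     (\<forall>c x. \<phi> (cscale c x) = cscale c (\<phi> x)) \<and>
     (\<forall>x y. \<phi> (x * y) = \<phi> x * \<phi> y) \<and>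
     (\<forall>x. \<phi> (adj x) = adj (\<phi> x))"

definition cstar_action :: "('g, 'm) monoid_scheme \<Rightarrow> ('g \<Rightarrow> 'a::cstar_algebra \<Rightarrow> 'a) \<Rightarrow> bool" where
  "cstar_action G \<beta> \<longleftrightarrow> (\<forall>g\<in>carrier G. star_automorphism (\<beta> g)) \<and>
     (\<forall>g\<in>carrier G. \<forall>h\<in>carrier G. \<beta> (g \<otimes>\<^bsub>G\<^esub> h) = \<beta> g \<circ> \<beta> h) \<and>
     \<beta> \<one>\<^bsub>G\<^esub> = id"

definition lcoset_space :: "('g, 'm) monoid_scheme \<Rightarrow> 'g set \<Rightarrow> 'g set set" where
  "lcoset_space G K = {g <#\<^bsub>G\<^esub> K | g. g \<in> carrier G}"

text \<open>An element of M(A) is a double centralizer (L,R): R(a) b = a L(b).\<close>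
type_synonym 'a mult = "('a \<Rightarrow> 'a) \<times> ('a \<Rightarrow> 'a)"

definition double_centralizer :: "'a::cstar_algebra mult \<Rightarrow> bool" where
  "double_centralizer x \<longleftrightarrow> (\<forall>a b. snd x a * b = a * fst x b)"

definition mmult :: "'a::cstar_algebra mult \<Rightarrow> 'a mult \<Rightarrow> 'a mult" where
  "mmult x y = (fst x \<circ> fst y, snd y \<circ> snd x)"

definition madj :: "'a::cstar_algebra mult \<Rightarrow> 'a mult" where
  "madj x = ((\<lambda>a. adj (snd x (adj a))), (\<lambda>a. adj (fst x (adj a))))"

definition mdiff :: "'a::cstar_algebra mult \<Rightarrow> 'a mult \<Rightarrow> 'a mult" where
  "mdiff x y = ((\<lambda>a. fst x a - fst y a), (\<lambda>a. snd x a - snd y a))"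

definition msum :: "('i \<Rightarrow> 'a::cstar_algebra mult) \<Rightarrow> 'i set \<Rightarrow> 'a mult" where
  "msum f S = ((\<lambda>a. \<Sum>i\<in>S. fst (f i) a), (\<lambda>a. \<Sum>i\<in>S. snd (f i) a))"

definition munit :: "'a::cstar_algebra mult" where
  "munit = (id, id)"

definition membed :: "'a::cstar_algebra \<Rightarrow> 'a mult" where
  "membed a = ((\<lambda>b. a * b), (\<lambda>b. b * a))"

definition mnorm :: "'a::cstar_algebra mult \<Rightarrow> real" where
  "mnorm x = onorm (fst x)"

definition mcomm :: "'a::cstar_algebra mult \<Rightarrow> 'a mult \<Rightarrow> 'a mult" where
  "mcomm x y = mdiff (mmult x y) (mmult y x)"

definition mpositive_contraction :: "'a::cstar_algebra mult \<Rightarrow> bool" where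
  "mpositive_contraction x \<longleftrightarrow> double_centralizer x \<and>
     (\<exists>y. double_centralizer y \<and> x = mmult (madj y) y) \<and> mnorm x \<le> 1"

definition maction :: "('g, 'm) monoid_scheme \<Rightarrow> ('g \<Rightarrow> 'a::cstar_algebra \<Rightarrow> 'a) \<Rightarrow> 'g \<Rightarrow> 'a mult \<Rightarrow> 'a mult" where
  "maction G \<beta> h x = (\<beta> h \<circ> fst x \<circ> \<beta> (inv\<^bsub>G\<^esub> h), \<beta> h \<circ> snd x \<circ> \<beta> (inv\<^bsub>G\<^esub> h))"

definition mult_rokhlin_towers ::
  "bool \<Rightarrow> ('g, 'm) monoid_scheme \<Rightarrow> 'g set \<Rightarrow> ('g \<Rightarrow> 'a::cstar_algebra \<Rightarrow> 'a) \<Rightarrow> nat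
   \<Rightarrow> real \<Rightarrow> 'g set \<Rightarrow> 'a set \<Rightarrow> (nat \<Rightarrow> 'g set \<Rightarrow> 'a mult) \<Rightarrow> bool" where
  "mult_rokhlin_towers comm G K \<beta> d \<epsilon> M F f \<longleftrightarrow>
     (\<forall>l\<le>d. \<forall>C\<in>lcoset_space G K. mpositive_contraction (f l C)) \<and>
     (\<forall>l\<le>d. \<forall>C\<in>lcoset_space G K. \<forall>D\<in>lcoset_space G K. C \<noteq> D \<longrightarrow>
        mnorm (mmult (f l C) (f l D)) < \<epsilon>) \<and>
     mnorm (mdiff (msum (\<lambda>(l, C). f l C) ({..d} \<times> lcoset_space G K)) munit) < \<epsilon> \<and>
     (\<forall>l\<le>d. \<forall>g\<in>carrier G. \<forall>h\<in>M.
        mnorm (mdiff (maction G \<beta> h (f l (g <#\<^bsub>G\<^esub> K))) (f l ((h \<otimes>\<^bsub>G\<^esub> g) <#\<^bsub>G\<^esub> K))) < \<epsilon>) \<and>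
     (\<forall>l\<le>d. \<forall>C\<in>lcoset_space G K. \<forall>a\<in>F. mnorm (mcomm (f l C) (membed a)) < \<epsilon>) \<and>
     (comm \<longrightarrow> (\<forall>k\<le>d. \<forall>l\<le>d. \<forall>C\<in>lcoset_space G K. \<forall>D\<in>lcoset_space G K.
        mnorm (mcomm (f l C) (f k D)) < \<epsilon>))"

definition mult_rokhlin_dim_le ::
  "bool \<Rightarrow> ('g, 'm) monoid_scheme \<Rightarrow> 'g set \<Rightarrow> ('g \<Rightarrow> 'a::cstar_algebra \<Rightarrow> 'a) \<Rightarrow> nat \<Rightarrow> bool" where
  "mult_rokhlin_dim_le comm G K \<beta> d \<longleftrightarrow>
     (\<forall>\<epsilon>>0. \<forall>M F. finite M \<and> M \<subseteq> carrier G \<and> finite F \<longrightarrow>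
        (\<exists>f. mult_rokhlin_towers comm G K \<beta> d \<epsilon> M F f))"

section \<open>Rokhlin dimension (Szabo-Wu-Zacharias, local form)\<close>

definition rokhlin_towers ::
  "bool \<Rightarrow> ('g, 'm) monoid_scheme \<Rightarrow> 'g set \<Rightarrow> ('g \<Rightarrow> 'a::cstar_algebra \<Rightarrow> 'a) \<Rightarrow> nat
   \<Rightarrow> real \<Rightarrow> 'g set \<Rightarrow> 'a set \<Rightarrow> (nat \<Rightarrow> 'g set \<Rightarrow> 'a) \<Rightarrow> bool" where
  "rokhlin_towers comm G K \<beta> d \<epsilon> M F f \<longleftrightarrow>
     (\<forall>l\<le>d. \<forall>C\<in>lcoset_space G K. positive_contraction (f l C)) \<and>
     (\<forall>a\<in>F. norm ((\<Sum>(l, C)\<in>{..d} \<times> lcoset_space G K. f l C) * a - a) < \<epsilon>) \<and>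
     (\<forall>a\<in>F. \<forall>l\<le>d. \<forall>C\<in>lcoset_space G K. \<forall>D\<in>lcoset_space G K. C \<noteq> D \<longrightarrow>
        norm (f l C * f l D * a) \<le> \<epsilon>) \<and>
     (\<forall>a\<in>F. \<forall>l\<le>d. \<forall>h\<in>carrier G. \<forall>g\<in>M.
        norm ((\<beta> g (f l (h <#\<^bsub>G\<^esub> K)) - f l ((g \<otimes>\<^bsub>G\<^esub> h) <#\<^bsub>G\<^esub> K)) * a) < \<epsilon>) \<and>
     (\<forall>a\<in>F. \<forall>l\<le>d. \<forall>C\<in>lcoset_space G K. norm (f l C * a - a * f l C) < \<epsilon>) \<and>
     (comm \<longrightarrow> (\<forall>a\<in>F. \<forall>k\<le>d. \<forall>l\<le>d. \<forall>C\<in>lcoset_space G K. \<forall>D\<in>lcoset_space G K.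
        norm ((f k C * f l D - f l D * f k C) * a) < \<epsilon>))"

definition rokhlin_dim_le ::
  "bool \<Rightarrow> ('g, 'm) monoid_scheme \<Rightarrow> 'g set \<Rightarrow> ('g \<Rightarrow> 'a::cstar_algebra \<Rightarrow> 'a) \<Rightarrow> nat \<Rightarrow> bool" where
  "rokhlin_dim_le comm G K \<beta> d \<longleftrightarrow>
     (\<forall>\<epsilon>>0. \<forall>M F. finite M \<and> M \<subseteq> carrier G \<and> finite F \<longrightarrow>
        (\<exists>f. rokhlin_towers comm G K \<beta> d \<epsilon> M F f))"

end

(* Pick a selfadjoint contraction e in A that is an approximate unit for the finitely many elements
   a, L(a), L(L'(a)), R(a) occurring in the tower conditions, and replace each multiplier f = (L, R)
   by e f e = e L(e).  Every condition of the local form is tested only against elements a of F, so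
   these approximations suffice and no quasicentrality of e is needed; e f e is positive because
   e y* y e = (y e)* (y e).

   Approximate units come from positivity in the unitization: with selfadjoint b and
   h = (sum of b^2) / M, the element 1 - (1 - h)^n works for large n. Positivity is handled without
   spectra, through the condition ||t - x|| <= t. *)

theory Submission
  imports Defs
begin


section \<open>Elementary facts on C*-algebras\<close>

text \<open>The tower is fixed first and \<open>e\<close> is chosen for it afterwards. Equivariance
  is the delicate condition, since \<open>\<beta> g\<close> moves \<open>e\<close>. Writing
  \<open>\<beta> g y * a\<close> as \<open>\<beta> g\<close> of \<open>y\<close> times the translate
  of \<open>a\<close> by the inverse of \<open>g\<close> avoids comparing \<open>e\<close> with its
  image: \<open>e\<close> only has to be an approximate unit near these translates too, and the
  error is carried back by the contraction \<open>\<beta> g\<close>.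

  Two gaps have to be filled before that. A double centralizer is just a pair of functions linked by
  one identity, so linearity and boundedness, without which an operator norm bounds nothing, must be
  derived. And with no functional calculus at hand, the substitute is a circle estimate: commuting
  selfadjoint \<open>a\<close>, \<open>b\<close> with \<open>a^2 + b^2 = M\<close> satisfy
  \<open>norm a ^ 2 \<le> M\<close>. From it follow positivity of squares, monotonicity of the norm
  and contractivity of star homomorphisms. Positivity of \<open>adj z * z\<close> is harder but
  needed, because the elements \<open>b\<close> in the approximate unit do not commute with each
  other.\<close>

lemma adj_zero [simp]: "adj (0::'a::cstar_algebra) = 0"
  using adj_add[of "0::'a" 0] by simp

lemma adj_minus [simp]: "adj (- x) = - adj (x::'a::cstar_algebra)"
  using adj_add[of x "- x"] by (simp add: eq_neg_iff_add_eq_0 add.commute)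

lemma adj_diff: "adj (x - y) = adj x - adj (y::'a::cstar_algebra)"
  using adj_add[of x "- y"] by simp

lemma adj_scaleR: "adj (scaleR r x) = scaleR r (adj (x::'a::cstar_algebra))"
  by (metis adj_cscale cscale_of_real complex_cnj_complex_of_real)

lemma norm_adj [simp]: "norm (adj x) = norm (x::'a::cstar_algebra)"
proof -
  have le: "norm y \<le> norm (adj y)" for y :: 'a
  proof (cases "norm y = 0")
    case False
    have "norm y * norm y \<le> norm (adj y) * norm y"
      using cstar_identity[of y] norm_mult_ineq[of "adj y" y] by (simp add: power2_eq_square)
    then show ?thesis using False by simp
  qed simp
  show ?thesis using le[of x] le[of "adj x"] by (simp add: adj_adj)
qed

lemma bounded_linear_adj: "bounded_linear (adj :: 'a::cstar_algebra \<Rightarrow> 'a)"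
  by (rule bounded_linear_intro[where K = 1]) (auto simp: adj_add adj_scaleR)

lemma cscale_zero [simp]: "cscale a (0::'a::cstar_algebra) = 0"
  using cscale_add_right[of a "0::'a" 0] by simp

lemma cscale_zero_left [simp]: "cscale 0 (x::'a::cstar_algebra) = 0"
  using cscale_add_left[of 0 0 x] by simp

lemma cscale_minus_left [simp]: "cscale (- a) (x::'a::cstar_algebra) = - cscale a x"
  using cscale_add_left[of a "- a" x] by (simp add: eq_neg_iff_add_eq_0 add.commute)

lemma cscale_minus_right [simp]: "cscale a (- x::'a::cstar_algebra) = - cscale a x"
  using cscale_add_right[of a x "- x"] by (simp add: eq_neg_iff_add_eq_0 add.commute)

lemma cscale_diff_right: "cscale a (x - y::'a::cstar_algebra) = cscale a x - cscale a y"
  using cscale_add_right[of a x "- y"] by simp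

lemma cscale_one [simp]: "cscale 1 (x::'a::cstar_algebra) = x"
  using cscale_of_real[of 1 x] by simp

lemma norm_square_selfadjoint:
  "adj x = x \<Longrightarrow> norm (x * x) = (norm (x::'a::cstar_algebra))\<^sup>2"
  using cstar_identity[of x] by simp

text \<open>The choice \<open>c = adj x\<close> and the C*-identity give
  \<open>norm x ^ 2 = 0\<close>. Through this, properties of \<open>fst x\<close> can be read off
  from products \<open>c * fst x b\<close>.\<close>

lemma eq_zero_if_left_annihilated:
  "(\<And>c. c * x = 0) \<Longrightarrow> x = (0::'a::cstar_algebra)"
  using cstar_identity[of x] by simp

lemma eq_if_left_mult_eq:
  "(\<And>c. c * x = c * y) \<Longrightarrow> x = (y::'a::cstar_algebra)"
  using eq_zero_if_left_annihilated[of "x - y"] by (simp add: right_diff_distrib)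

lemma selfadjoint_decomposition:
  fixes x :: "'a::cstar_algebra"
  obtains s t where "adj s = s" "adj t = t" "x = s + cscale \<i> t"
proof
  let ?s = "scaleR (1/2) (x + adj x)" and ?t = "cscale (- \<i> / 2) (x - adj x)"
  show "adj ?s = ?s" by (simp add: adj_scaleR adj_add adj_adj add.commute)
  have "adj ?t = cscale (\<i> / 2) (adj x - x)"
    by (simp add: adj_cscale adj_diff adj_adj)
  also have "\<dots> = - cscale (\<i> / 2) (x - adj x)"
    by (metis cscale_minus_right minus_diff_eq)
  also have "\<dots> = ?t" by (simp flip: cscale_minus_left)
  finally show "adj ?t = ?t" .
  have "cscale \<i> ?t = cscale (complex_of_real (1/2)) (x - adj x)"
    by (simp add: cscale_cscale)
  also have "\<dots> = scaleR (1/2) (x - adj x)" by (rule cscale_of_real)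
  finally show "x = ?s + cscale \<i> ?t"
    by (simp add: algebra_simps flip: scaleR_add_left)
qed

section \<open>Double centralizers are bounded module maps\<close>

lemma double_centralizerD:
  "double_centralizer x \<Longrightarrow> a * fst x b = snd x a * (b::'a::cstar_algebra)"
  by (simp add: double_centralizer_def)

text \<open>After multiplication by \<open>c\<close> on the left, \<open>fst x\<close> becomes the
  factor \<open>snd x c\<close>, and the claim turns into associativity. Additivity and homogeneity
  below follow in the same way.\<close>

lemma double_centralizer_mult_right:
  assumes "double_centralizer (x::'a::cstar_algebra mult)"
  shows "fst x (a * b) = fst x a * b"
  by (rule eq_if_left_mult_eq) (simp add: double_centralizerD[OF assms] flip: mult.assoc)

lemma double_centralizer_add:
  assumes "double_centralizer (x::'a::cstar_algebra mult)"
  shows "fst x (a + b) = fst x a + fst x b"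
  by (rule eq_if_left_mult_eq) (simp add: double_centralizerD[OF assms] distrib_left)

lemma double_centralizer_scaleR:
  assumes "double_centralizer (x::'a::cstar_algebra mult)"
  shows "fst x (scaleR r a) = scaleR r (fst x a)"
  by (rule eq_if_left_mult_eq) (simp add: double_centralizerD[OF assms])

lemma double_centralizer_norm_mult_le:
  fixes x :: "'a::cstar_algebra mult"
  assumes "double_centralizer x"
  shows "norm (a * fst x b) \<le> norm (snd x a) * norm b"
  using assms norm_mult_ineq[of "snd x a" b] by (simp add: double_centralizer_def)

text \<open>Baire category: the closed sets of all \<open>a\<close> with \<open>\<parallel>a L(b)\<parallel> \<le> n \<parallel>b\<parallel>\<close> for every \<open>b\<close> cover the
  algebra because \<open>a L(b) = R(a) b\<close>.  On a ball in one of them, \<open>a = (L b)* \<close> rescaled bounds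
  \<open>\<parallel>L b\<parallel>\<close> through the C*-identity.\<close>

lemma double_centralizer_bounded_linear:
  fixes x :: "'a::cstar_algebra mult"
  assumes dc: "double_centralizer x"
  shows "bounded_linear (fst x)"
proof -
  define E where "E n = {a::'a. \<forall>b. norm (a * fst x b) \<le> real n * norm b}" for n
  have closed: "closed (E n)" for n
    unfolding E_def
    by (intro closed_Collect_all closed_Collect_le continuous_intros)
  have cover: "\<exists>n. a \<in> E n" for a
  proof -
    obtain n where "norm (snd x a) \<le> real n" using real_arch_simple by blast
    then have "norm (a * fst x b) \<le> real n * norm b" for b
      by (rule order_trans[OF double_centralizer_norm_mult_le[OF dc] mult_right_mono]) simp
    then show ?thesis by (auto simp: E_def)
  qed
  have "\<exists>n. interior (E n) \<noteq> {}"
  proof (rule ccontr)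
    assume no: "\<not> ?thesis"
    have "euclidean closure_of (\<Inter> (range (\<lambda>n. - E n))) = topspace euclidean"
    proof (rule Baire_category)
      show "openin euclidean T \<and> euclidean closure_of T = topspace euclidean"
        if "T \<in> range (\<lambda>n. - E n)" for T
        using that closed no by (auto simp: closure_complement)
    qed (auto simp: completely_metrizable_space_euclidean)
    moreover have "\<Inter> (range (\<lambda>n. - E n)) = {}" using cover by auto
    ultimately show False by simp
  qed
  then obtain n a0 r where r: "r > 0" "cball a0 r \<subseteq> E n"
    by (metis ex_in_conv mem_interior_cball)
  \<comment> \<open>Recentring the ball at \<open>0\<close> writes \<open>a\<close> as a difference
    of two points of \<open>E n\<close>, which costs the factor \<open>2\<close>.\<close>
  have small: "norm (a * fst x b) \<le> 2 * (real n * norm b)" if "norm a \<le> r" for a b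
  proof -
    have "a0 + a \<in> E n" "a0 \<in> E n" using r that by (auto simp: dist_norm)
    then have "norm ((a0 + a) * fst x b) \<le> real n * norm b" "norm (a0 * fst x b) \<le> real n * norm b"
      by (auto simp: E_def)
    moreover have "a * fst x b = (a0 + a) * fst x b - a0 * fst x b" by (simp add: algebra_simps)
    then have "norm (a * fst x b) \<le> norm ((a0 + a) * fst x b) + norm (a0 * fst x b)"
      by (simp only: norm_triangle_ineq4)
    ultimately show ?thesis by linarith
  qed
  have bd: "norm (fst x b) \<le> norm b * (2 * real n / r)" for b
  proof (cases "fst x b = 0")
    case True then show ?thesis using r by simp
  next
    case False
    let ?y = "fst x b"
    have "norm (scaleR (r / norm ?y) (adj ?y) * ?y) \<le> 2 * (real n * norm b)"
      by (rule small) (use False r in simp)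
    moreover have "norm (scaleR (r / norm ?y) (adj ?y) * ?y) = r * norm ?y"
      using False r by (simp add: cstar_identity power2_eq_square)
    ultimately show ?thesis using r by (simp add: field_simps)
  qed
  show ?thesis
    by (rule bounded_linear_intro[where K = "2 * real n / r"])
      (use dc bd in \<open>auto simp: double_centralizer_add double_centralizer_scaleR\<close>)
qed

section \<open>Unital C*-algebras\<close>

class cstar_algebra_1 = cstar_algebra + real_normed_algebra_1

lemma adj_one [simp]: "adj (1::'a::cstar_algebra_1) = 1"
  by (metis adj_adj adj_mult mult.left_neutral mult.right_neutral)

lemma adj_power: "adj (x ^ n) = adj (x::'a::cstar_algebra_1) ^ n"
  by (induction n) (auto simp: adj_mult power_commutes)

text \<open>With \<open>y = 1 - z\<close>, the root is \<open>1 - w\<close> where \<open>w\<close> is the limit of the iteration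
  \<open>w \<leftarrow> (z + w\<^sup>2) / 2\<close>; its increments are dominated by those of the scalar iteration for \<open>z = 1\<close>.\<close>

lemma square_root_near_one:
  fixes y :: "'a::cstar_algebra_1"
  assumes sa: "adj y = y" and le: "norm (1 - y) \<le> 1"
  obtains k where "adj k = k" "k * k = y" "norm (1 - k) \<le> 1"
    "\<And>z. z * y = y * z \<Longrightarrow> z * k = k * z"
proof -
  define z where "z = 1 - y"
  have z: "norm z \<le> 1" "adj z = z" using le sa by (auto simp: z_def adj_diff)
  define w where "w = rec_nat (0::'a) (\<lambda>_ v. scaleR (1/2) (z + v * v))"
  define s where "s = rec_nat (0::real) (\<lambda>_ v. (1 + v * v) / 2)"
  have w: "w 0 = 0" "\<And>n. w (Suc n) = scaleR (1/2) (z + w n * w n)" by (auto simp: w_def)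
  have s: "s 0 = 0" "\<And>n. s (Suc n) = (1 + s n * s n) / 2" by (auto simp: s_def)
  have s01: "0 \<le> s n \<and> s n \<le> 1" for n
    by (induction n) (auto simp: s mult_le_one)
  \<comment> \<open>Here \<open>s (Suc n) - s n = (1 - s n)^2 / 2\<close>.\<close>
  have sinc: "s n \<le> s (Suc n)" for n
    using sum_squares_ge_zero[of "s n - 1" 0] by (simp add: s algebra_simps)
  have ws: "norm (w n) \<le> s n" for n
  proof (induction n)
    case (Suc n)
    have "norm (w n * w n) \<le> s n * s n"
      using Suc by (meson mult_mono norm_ge_zero norm_mult_ineq order_trans)
    then have "norm (z + w n * w n) \<le> 1 + s n * s n"
      using z(1) norm_triangle_ineq[of z "w n * w n"] by linarith
    then show ?case by (simp add: w s)
  qed (simp add: w s)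
  \<comment> \<open>For the scalar iteration the estimate is an equality: the next increment is
    \<open>(s (Suc n) + s n) / 2\<close> times the current one. In the algebra the two factors stand
    on either side of the increment.\<close>
  have step: "norm (w (Suc n) - w n) \<le> s (Suc n) - s n" for n
  proof (induction n)
    case 0 then show ?case using z by (simp add: w s)
  next
    case (Suc n)
    let ?d = "w (Suc n) - w n" and ?e = "s (Suc n) - s n"
    have "w (Suc (Suc n)) - w (Suc n) =
        scaleR (1/2) (w (Suc n) * w (Suc n) - w n * w n)"
      unfolding w(2)[of "Suc n"] by (subst (3) w(2)) (simp flip: scaleR_diff_right)
    also have "w (Suc n) * w (Suc n) - w n * w n = w (Suc n) * ?d + ?d * w n"
      by (simp add: algebra_simps)
    finally have eq: "w (Suc (Suc n)) - w (Suc n) = scaleR (1/2) (w (Suc n) * ?d + ?d * w n)" .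
    have "norm (w (Suc n) * ?d) \<le> s (Suc n) * ?e" "norm (?d * w n) \<le> ?e * s n"
      using ws Suc s01 by (meson mult_mono norm_ge_zero norm_mult_ineq order_trans)+
    then have "norm (w (Suc n) * ?d + ?d * w n) \<le> s (Suc n) * ?e + ?e * s n"
      using norm_triangle_ineq[of "w (Suc n) * ?d" "?d * w n"] by linarith
    also have "\<dots> = 2 * (s (Suc (Suc n)) - s (Suc n))"
      unfolding s(2)[of "Suc n"] by (subst (6) s(2)) (simp add: algebra_simps)
    finally show ?case by (simp add: eq)
  qed
  have "convergent s"
    by (rule Bseq_mono_convergent) (use s01 sinc in \<open>auto intro!: BseqI'[of _ 1] simp: lift_Suc_mono_le\<close>)
  then have "summable (\<lambda>n. s (Suc n) - s n)"
    using telescope_summable convergent_LIMSEQ_iff by blast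
  then have "summable (\<lambda>n. norm (w (Suc n) - w n))"
    by (rule summable_comparison_test[rotated]) (use step in auto)
  then have "summable (\<lambda>n. w (Suc n) - w n)" by (rule summable_norm_cancel)
  then have "convergent (\<lambda>n. \<Sum>i<n. w (Suc i) - w i)" by (simp add: summable_iff_convergent)
  moreover have "(\<Sum>i<n. w (Suc i) - w i) = w n" for n
    unfolding sum_lessThan_telescope by (simp add: w(1))
  ultimately obtain v where v: "w \<longlonglongrightarrow> v"
    by (auto simp: convergent_def)
  have "norm v \<le> 1"
    by (rule LIMSEQ_le_const2[OF tendsto_norm[OF v]]) (use ws s01 order_trans in blast)
  have "(\<lambda>n. w (Suc n)) \<longlonglongrightarrow> scaleR (1/2) (z + v * v)"
    unfolding w by (intro tendsto_intros v)
  then have vfix: "v = scaleR (1/2) (z + v * v)"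
    using v LIMSEQ_Suc LIMSEQ_unique by blast
  have "adj (w n) = w n" for n
    by (induction n) (auto simp: w adj_scaleR adj_add adj_mult z)
  then have sav: "adj v = v"
    using bounded_linear.tendsto[OF bounded_linear_adj v] v LIMSEQ_unique by auto
  have comm: "u * v = v * u" if "u * y = y * u" for u
  proof -
    have uz: "u * z = z * u" using that by (simp add: z_def algebra_simps)
    have "u * w n = w n * u" for n
    proof (induction n)
      case (Suc n)
      have "u * (w n * w n) = (w n * w n) * u" using Suc by (metis mult.assoc)
      then show ?case by (simp add: w uz algebra_simps)
    qed (simp add: w)
    then show ?thesis
      using tendsto_mult_left[OF v, of u] tendsto_mult_right[OF v, of u] LIMSEQ_unique by auto
  qed
  \<comment> \<open>The fixed-point equation rearranges to
    \<open>(1 - v)^2 = 1 - z = y\<close>.\<close>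
  have "v + v = z + v * v"
    using arg_cong[OF vfix, of "scaleR 2"] by (simp add: scaleR_2)
  then have "adj (1 - v) = 1 - v" "(1 - v) * (1 - v) = y" "norm (1 - (1 - v)) \<le> 1"
    using sav \<open>norm v \<le> 1\<close> by (simp_all add: adj_diff z_def algebra_simps)
  moreover have "u * (1 - v) = (1 - v) * u" if "u * y = y * u" for u
    using comm[OF that] by (simp add: algebra_simps)
  ultimately show ?thesis by (rule that[of "1 - v"])
qed


section \<open>Positivity in unital C*-algebras\<close>

text \<open>The element \<open>u = a + i b\<close> satisfies
  \<open>adj u * u = a^2 + b^2 = M\<close> because \<open>a\<close> and \<open>b\<close> commute,
  and \<open>a\<close> is its real part, so \<open>norm a \<le> norm u\<close>.\<close>

lemma unit_circle_bound:
  fixes a b :: "'a::cstar_algebra_1"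
  assumes sa: "adj a = a" "adj b = b" and comm: "a * b = b * a"
    and sum: "a * a + b * b = of_real M" and "0 \<le> M"
  shows "(norm a)\<^sup>2 \<le> M"
proof -
  define u where "u = a + cscale \<i> b"
  have adj_u: "adj u = a - cscale \<i> b"
    using sa by (simp add: u_def adj_add adj_cscale)
  have "adj u * u = a * a + b * b"
    unfolding adj_u unfolding u_def
    by (simp add: algebra_simps comm cscale_cscale cscale_add_right cscale_diff_right flip: cscale_mult_left cscale_mult_right)
  then have "(norm u)\<^sup>2 = M"
    using cstar_identity[of u] sum \<open>0 \<le> M\<close> by simp
  moreover have "a = scaleR (1/2) (u + adj u)"
    unfolding adj_u by (simp add: u_def flip: scaleR_2)
  then have "norm a \<le> norm u"
    using norm_triangle_ineq[of u "adj u"] by (auto dest!: arg_cong[of a _ norm])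
  ultimately show ?thesis by (metis norm_ge_zero power_mono)
qed

text \<open>For selfadjoint \<open>x\<close> the inequality says that the spectrum lies in
  \<open>[0, 2 t]\<close>. In this form, closure under sums and nonnegative multiples needs only the
  triangle inequality.\<close>

definition cpos :: "'a::cstar_algebra_1 \<Rightarrow> bool" where
  "cpos x \<longleftrightarrow> adj x = x \<and> (\<exists>t. norm (of_real t - x) \<le> t)"

lemma adj_of_real [simp]: "adj (of_real r :: 'a::cstar_algebra_1) = of_real r"
  by (simp add: of_real_def adj_scaleR)

lemma cpos_adj: "cpos x \<Longrightarrow> adj x = x"
  by (simp add: cpos_def)

lemma norm_of_real_diff_mono:
  fixes x :: "'a::cstar_algebra_1"
  assumes "norm (of_real t - x) \<le> t" "t \<le> s"
  shows "norm (of_real s - x) \<le> s"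
proof -
  have "of_real s - x = of_real (s - t) + (of_real t - x)" by simp
  then have "norm (of_real s - x) \<le> norm (of_real (s - t) :: 'a) + norm (of_real t - x)"
    by (simp only: norm_triangle_ineq)
  also have "norm (of_real (s - t) :: 'a) = s - t" using assms(2) unfolding norm_of_real by simp
  finally show ?thesis using assms(1) by simp
qed

lemma cpos_add:
  assumes "cpos x" "cpos y" shows "cpos (x + y)"
proof -
  obtain s t where "norm (of_real s - x) \<le> s" "norm (of_real t - y) \<le> t"
    using assms by (auto simp: cpos_def)
  then have "norm ((of_real s - x) + (of_real t - y)) \<le> s + t" by (meson norm_triangle_mono)
  moreover have "(of_real s - x) + (of_real t - y) = of_real (s + t) - (x + y)" by simp
  ultimately show ?thesis using assms by (auto simp: cpos_def adj_add intro!: exI[of _ "s + t"])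
qed

lemma cpos_scaleR:
  assumes "cpos x" "0 \<le> r" shows "cpos (scaleR r x)"
proof -
  obtain t where "norm (of_real t - x) \<le> t" using assms by (auto simp: cpos_def)
  then have "norm (scaleR r (of_real t - x)) \<le> r * t"
    using assms(2) by (simp add: mult_left_mono)
  moreover have "scaleR r (of_real t - x) = of_real (r * t) - scaleR r x"
    by (simp add: of_real_def scaleR_diff_right)
  ultimately show ?thesis using assms by (auto simp: cpos_def adj_scaleR intro!: exI[of _ "r * t"])
qed

lemma cpos_of_real: "0 \<le> r \<Longrightarrow> cpos (of_real r)"
  by (auto simp: cpos_def intro!: exI[of _ r])

lemma cpos_zero: "cpos 0"
  using cpos_of_real[of 0] by simp

lemma cpos_sum: "(\<And>i. i \<in> S \<Longrightarrow> cpos (f i)) \<Longrightarrow> cpos (sum f S)"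
  by (induction S rule: infinite_finite_induct) (auto simp: cpos_zero cpos_add)

text \<open>With the witness \<open>t = norm x\<close>, the element measured is \<open>x\<close>
  itself.\<close>

lemma cpos_norm_diff: "adj x = x \<Longrightarrow> cpos (of_real (norm x) - x)"
  by (auto simp: cpos_def adj_diff intro!: exI[of _ "norm x"])

text \<open>Rescaling by \<open>t\<close> reduces to an element within distance one of
  \<open>1\<close>. The commutation clause stands in for functional calculus: whatever commutes with
  \<open>x\<close> commutes with the root.\<close>

lemma cpos_square_root:
  fixes x :: "'a::cstar_algebra_1"
  assumes "cpos x"
  obtains k where "cpos k" "k * k = x" "\<And>z. z * x = x * z \<Longrightarrow> z * k = k * z"
proof -
  obtain t0 where t0: "norm (of_real t0 - x) \<le> t0" using assms by (auto simp: cpos_def)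
  \<comment> \<open>The given \<open>t0\<close> may be \<open>0\<close>; the larger \<open>t\<close>
    can be divided by.\<close>
  define t where "t = t0 + 1"
  have "0 \<le> t0" using t0 norm_ge_zero order_trans by blast
  then have t: "t > 0" "norm (of_real t - x) \<le> t"
    using norm_of_real_diff_mono[OF t0, of t] by (auto simp: t_def)
  define y where "y = scaleR (1 / t) x"
  have "1 - y = scaleR (1 / t) (of_real t - x)"
    using t by (simp add: y_def of_real_def scaleR_diff_right)
  then have "norm (1 - y) = norm (of_real t - x) / t" using t by simp
  then have "norm (1 - y) \<le> 1" using t by simp
  moreover have "adj y = y" using assms by (simp add: y_def cpos_def adj_scaleR)
  ultimately obtain k where k: "adj k = k" "k * k = y" "norm (1 - k) \<le> 1"
    "\<And>z. z * y = y * z \<Longrightarrow> z * k = k * z"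
    using square_root_near_one by blast
  have "cpos k" using k(1,3) by (auto simp: cpos_def intro!: exI[of _ 1])
  then have "cpos (scaleR (sqrt t) k)" using t by (simp add: cpos_scaleR)
  moreover have "scaleR (sqrt t) k * scaleR (sqrt t) k = x"
    using t k(2) by (simp add: y_def)
  moreover have "z * scaleR (sqrt t) k = scaleR (sqrt t) k * z" if "z * x = x * z" for z
    using k(4)[of z] that by (simp add: y_def)
  ultimately show ?thesis by (rule that)
qed

text \<open>The sine to the cosine \<open>k\<close>: \<open>m\<close> is the square root of
  \<open>norm k ^ 2 - k^2\<close>. It supplies the partner that \<open>unit_circle_bound\<close>
  asks for.\<close>

lemma selfadjoint_circle_complement:
  fixes k :: "'a::cstar_algebra_1"
  assumes sa: "adj k = k"
  obtains m where "adj m = m" "k * m = m * k" "k * k + m * m = of_real ((norm k)\<^sup>2)"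
proof -
  let ?y = "of_real ((norm k)\<^sup>2) - k * k"
  have "cpos ?y"
    using cpos_norm_diff[of "k * k"] sa by (simp add: adj_mult norm_square_selfadjoint)
  then obtain m where m: "cpos m" "m * m = ?y" "\<And>z. z * ?y = ?y * z \<Longrightarrow> z * m = m * z"
    using cpos_square_root by blast
  have "k * ?y = ?y * k" by (simp add: of_real_def algebra_simps)
  from m(3)[OF this] show ?thesis using that[of m] m(1,2) by (simp add: cpos_adj)
qed

text \<open>The circle relation is symmetric, so \<open>m\<close> is bounded by
  \<open>norm k\<close> as well. Since \<open>m * m\<close> is \<open>norm k ^ 2 - k * k\<close>,
  this is the defining inequality with \<open>t = norm k ^ 2\<close>.\<close>

lemma cpos_square:
  fixes k :: "'a::cstar_algebra_1"
  assumes sa: "adj k = k"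
  shows "cpos (k * k)"
proof -
  obtain m where m: "adj m = m" "k * m = m * k" "k * k + m * m = of_real ((norm k)\<^sup>2)"
    using selfadjoint_circle_complement[OF sa] by blast
  have "(norm m)\<^sup>2 \<le> (norm k)\<^sup>2"
    by (rule unit_circle_bound[of m k]) (use m sa in \<open>simp_all add: add.commute\<close>)
  moreover have "of_real ((norm k)\<^sup>2) - k * k = m * m" using m(3) by (simp add: algebra_simps)
  ultimately have "norm (of_real ((norm k)\<^sup>2) - k * k) \<le> (norm k)\<^sup>2"
    using m norm_square_selfadjoint by metis
  then show ?thesis using sa by (auto simp: cpos_def adj_mult simp del: of_real_power)
qed

text \<open>The square roots of \<open>x\<close> and \<open>M - x\<close> commute and form a circle
  pair of squared radius \<open>M\<close>.\<close>

lemma cpos_norm_le: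
  fixes x :: "'a::cstar_algebra_1"
  assumes "cpos x" "cpos (of_real M - x)" "0 \<le> M"
  shows "norm x \<le> M"
proof -
  obtain k where k: "cpos k" "k * k = x" using cpos_square_root[OF assms(1)] by blast
  obtain m where m: "cpos m" "m * m = of_real M - x"
    "\<And>z. z * (of_real M - x) = (of_real M - x) * z \<Longrightarrow> z * m = m * z"
    using cpos_square_root[OF assms(2)] by blast
  have "k * m = m * k"
    by (rule m(3)) (simp add: of_real_def algebra_simps flip: k(2))
  then have "(norm k)\<^sup>2 \<le> M"
    using k m(1,2) assms(3) by (intro unit_circle_bound[of k m]) (auto simp: cpos_adj)
  then show ?thesis using k cpos_adj norm_square_selfadjoint by metis
qed

lemma cpos_norm_mono:
  fixes x :: "'a::cstar_algebra_1"
  assumes "cpos x" "cpos (y - x)"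
  shows "norm x \<le> norm y"
proof (rule cpos_norm_le[OF assms(1)])
  have "adj y = y" using cpos_add[OF assms] by (simp add: cpos_adj)
  then show "cpos (of_real (norm y) - x)"
    using cpos_add[OF cpos_norm_diff[of y] assms(2)] by simp
qed simp

lemma cpos_antisym: "cpos x \<Longrightarrow> cpos (- x) \<Longrightarrow> x = 0"
  using cpos_norm_mono[of x 0] by simp

lemma cpos_mult_commute:
  fixes x :: "'a::cstar_algebra_1"
  assumes "cpos x" "cpos y" and comm: "x * y = y * x"
  shows "cpos (x * y)"
proof -
  obtain k where k: "cpos k" "k * k = x" "\<And>z. z * x = x * z \<Longrightarrow> z * k = k * z"
    using cpos_square_root[OF assms(1)] by blast
  obtain m where m: "cpos m" "m * m = y" "\<And>z. z * y = y * z \<Longrightarrow> z * m = m * z"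
    using cpos_square_root[OF assms(2)] by blast
  \<comment> \<open>The commutation clause is used twice: \<open>y\<close> commutes with
    \<open>x\<close>, hence with \<open>k\<close>; then \<open>k\<close> commutes with
    \<open>y\<close>, hence with \<open>m\<close>.\<close>
  have "k * m = m * k" using comm k(3)[of y] m(3)[of k] by simp
  moreover from this have "x * y = (k * m) * (k * m)"
    unfolding k(2)[symmetric] m(2)[symmetric] by (metis mult.assoc)
  ultimately show ?thesis
    using cpos_square[of "k * m"] k(1) m(1) by (simp add: adj_mult cpos_adj)
qed

text \<open>Repeated squaring with the C*-identity. Exponents \<open>2 ^ m\<close> suffice to play
  exponential growth against a linear bound.\<close>

lemma norm_power_two_power_selfadjoint:
  fixes x :: "'a::cstar_algebra_1"
  assumes "adj x = x"
  shows "norm (x ^ (2 ^ m)) = norm x ^ (2 ^ m)"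
proof (induction m)
  case (Suc m)
  have "x ^ (2 ^ Suc m) = x ^ (2 ^ m) * x ^ (2 ^ m)" by (simp add: mult_2 power_add)
  then show ?case
    using Suc assms norm_square_selfadjoint[of "x ^ (2 ^ m)"]
    by (simp add: adj_power power_mult[symmetric] mult.commute)
qed simp

text \<open>For \<open>p = w w* / s\<close> and \<open>q = w* w / s\<close> one has \<open>(1 - q)^n = 1 - w* (\<Sum>k<n. (1 - p)^k) w / s\<close>.
  If \<open>\<parallel>1 - p\<parallel> \<le> 1\<close> this grows at most linearly in \<open>n\<close>, so \<open>\<parallel>1 - q\<parallel> > 1\<close> is impossible.\<close>

lemma cpos_swap:
  fixes w :: "'a::cstar_algebra_1"
  assumes "cpos (w * adj w)"
  shows "cpos (adj w * w)"
proof -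
  obtain t0 where t0: "norm (of_real t0 - w * adj w) \<le> t0" using assms by (auto simp: cpos_def)
  define s where "s = t0 + 1"
  have "0 \<le> t0" using t0 norm_ge_zero order_trans by blast
  then have s: "s > 0" "norm (of_real s - w * adj w) \<le> s"
    using norm_of_real_diff_mono[OF t0, of s] by (auto simp: s_def)
  define p where "p = scaleR (1 / s) (w * adj w)"
  define q where "q = scaleR (1 / s) (adj w * w)"
  have "1 - p = scaleR (1 / s) (of_real s - w * adj w)"
    using s by (simp add: p_def of_real_def scaleR_diff_right)
  then have "norm (1 - p) = norm (of_real s - w * adj w) / s" using s by simp
  then have p: "norm (1 - p) \<le> 1" using s by simp
  \<comment> \<open>Since \<open>adj w\<close> intertwines \<open>1 - q\<close> and
    \<open>1 - p\<close>, each increment of the powers of \<open>1 - q\<close> is controlled by a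
    power of the contraction \<open>1 - p\<close>.\<close>
  have shift: "(1 - q) ^ n * adj w = adj w * (1 - p) ^ n" for n
  proof (induction n)
    case (Suc n)
    have "(1 - q) * adj w = adj w * (1 - p)"
      by (simp add: p_def q_def algebra_simps)
    then show ?case using Suc by (metis mult.assoc power_Suc power_Suc2)
  qed simp
  define C where "C = (norm w)\<^sup>2 / s"
  have C: "C \<ge> 0" using s by (simp add: C_def)
  have bound: "norm ((1 - q) ^ n) \<le> 1 + real n * C" for n
  proof (induction n)
    case (Suc n)
    have "(1 - q) ^ n * q = scaleR (1 / s) ((1 - q) ^ n * adj w * w)"
      by (simp add: q_def mult.assoc)
    also have "\<dots> = scaleR (1 / s) (adj w * (1 - p) ^ n * w)" by (simp only: shift)
    finally have eq: "(1 - q) ^ n * q = scaleR (1 / s) (adj w * (1 - p) ^ n * w)" .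
    have "norm ((1 - p) ^ n) \<le> 1"
      using norm_power_ineq[of "1 - p" n] p by (meson norm_ge_zero order_trans power_le_one)
    then have "norm (adj w * (1 - p) ^ n) \<le> norm w * 1"
      by (metis norm_adj mult_left_mono norm_ge_zero norm_mult_ineq order_trans)
    then have "norm (adj w * (1 - p) ^ n * w) \<le> norm w * norm w"
      by (metis mult_right_mono norm_ge_zero norm_mult_ineq order_trans mult_1_right)
    then have "norm ((1 - q) ^ n * q) \<le> C"
      unfolding eq C_def using s by (simp add: power2_eq_square divide_right_mono)
    moreover have "(1 - q) ^ Suc n = (1 - q) ^ n - (1 - q) ^ n * q"
      unfolding power_Suc2 by (simp add: algebra_simps)
    ultimately show ?case
      using Suc norm_triangle_ineq4[of "(1 - q) ^ n" "(1 - q) ^ n * q"]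
      by (simp add: algebra_simps)
  qed simp
  have saq: "adj (1 - q) = 1 - q" by (simp add: q_def adj_diff adj_scaleR adj_mult adj_adj)
  have "norm (1 - q) \<le> 1"
  proof (rule ccontr)
    let ?r = "norm (1 - q)"
    assume "\<not> ?r \<le> 1"
    then have r: "?r > 1" by simp
    then have "(\<lambda>n. real n / ?r ^ n) \<longlonglongrightarrow> 0" by (intro lim_n_over_pown) simp
    moreover have "strict_mono (\<lambda>m. 2 ^ m :: nat)" by (simp add: strict_mono_def)
    ultimately have "(\<lambda>m. real (2 ^ m) / ?r ^ (2 ^ m)) \<longlonglongrightarrow> 0"
      using LIMSEQ_subseq_LIMSEQ unfolding comp_def by fastforce
    \<comment> \<open>The linear bound keeps this ratio away from \<open>0\<close>, while
      \<open>?r > 1\<close> would force it to tend to \<open>0\<close>.\<close>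
    moreover have "1 / (1 + C) \<le> real (2 ^ m) / ?r ^ (2 ^ m)" for m
    proof -
      have "?r ^ (2 ^ m) \<le> 1 + real (2 ^ m) * C"
        using bound[of "2 ^ m"] norm_power_two_power_selfadjoint[OF saq] by simp
      also have "\<dots> \<le> real (2 ^ m) * (1 + C)" by (simp add: algebra_simps)
      finally have "?r ^ (2 ^ m) \<le> real (2 ^ m) * (1 + C)" .
      moreover have "0 < ?r ^ (2 ^ m)" by (rule zero_less_power) (use r in linarith)
      ultimately show ?thesis using C by (simp add: divide_simps mult.commute)
    qed
    ultimately have "1 / (1 + C) \<le> 0" using LIMSEQ_le_const by blast
    then show False using C by (simp add: field_simps)
  qed
  then have "cpos q" using saq by (auto simp: cpos_def adj_diff intro!: exI[of _ 1])
  then have "cpos (scaleR s q)" using s by (simp add: cpos_scaleR)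
  then show ?thesis using s by (simp add: q_def)
qed

text \<open>With \<open>a = |x|\<close> for \<open>x = z* z\<close> and \<open>n = a - x\<close>, the element \<open>w = z n\<close> satisfies
  \<open>w* w = - a n\<^sup>2 \<le> 0\<close>, while \<open>w w* + w* w \<ge> 0\<close> forces \<open>w w* \<ge> 0\<close>.\<close>

lemma cpos_adj_mult:
  fixes z :: "'a::cstar_algebra_1"
  shows "cpos (adj z * z)"
proof -
  define x where "x = adj z * z"
  have sax: "adj x = x" by (simp add: x_def adj_mult adj_adj)
  obtain a where a: "cpos a" "a * a = x * x" "\<And>y. y * (x * x) = (x * x) * y \<Longrightarrow> y * a = a * y"
    using cpos_square_root[OF cpos_square[OF sax]] by blast
  have ax: "x * a = a * x" by (rule a(3)) (simp add: mult.assoc)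
  obtain r where r: "cpos r" "r * r = a" "\<And>y. y * a = a * y \<Longrightarrow> y * r = r * y"
    using cpos_square_root[OF a(1)] by blast
  define n where "n = a - x"
  have san: "adj n = n" using a(1) sax by (simp add: n_def adj_diff cpos_adj)
  have na: "n * a = a * n" and nx: "n * x = x * n" by (auto simp: n_def algebra_simps ax)
  have nr: "n * r = r * n" by (rule r(3)[OF na])
  define w where "w = z * n"
  have "adj w * w = n * (x * n)"
    by (simp add: w_def x_def adj_mult san mult.assoc)
  also have "\<dots> = x * n * n" by (metis mult.assoc nx)
  finally have ww: "adj w * w = x * n * n" .
  have rn: "(r * n) * (r * n) = a * n * n" by (metis mult.assoc nr r(2))
  \<comment> \<open>This is \<open>(a + x) (a - x) = a^2 - x^2 = 0\<close>. Hence
    \<open>x n^2 = - a n^2\<close>, and \<open>a n^2\<close> is the square of \<open>r n\<close>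
    because \<open>r\<close> and \<open>n\<close> commute.\<close>
  have "(x + a) * n = 0" by (simp add: n_def algebra_simps ax a(2))
  then have "x * n * n + a * n * n = 0" by (metis distrib_right mult_zero_left)
  then have neg: "- (adj w * w) = (r * n) * (r * n)" unfolding ww rn by (rule minus_unique)
  have pos_neg: "cpos (- (adj w * w))"
    unfolding neg by (rule cpos_square) (use r(1) san nr in \<open>simp add: adj_mult cpos_adj\<close>)
  obtain s t where st: "adj s = s" "adj t = t" "w = s + cscale \<i> t"
    using selfadjoint_decomposition by blast
  have adj_w: "adj w = s - cscale \<i> t" using st by (simp add: adj_add adj_cscale)
  have "w * adj w + adj w * w = scaleR 2 (s * s + t * t)"
    unfolding adj_w unfolding st(3)
    by (simp add: algebra_simps cscale_cscale cscale_add_right cscale_diff_right scaleR_2 flip: cscale_mult_left cscale_mult_right)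
  then have "w * adj w = scaleR 2 (s * s + t * t) + - (adj w * w)" by (simp add: algebra_simps)
  moreover have "cpos (scaleR 2 (s * s + t * t))"
    using st by (intro cpos_scaleR cpos_add cpos_square) auto
  ultimately have "cpos (w * adj w)" using cpos_add pos_neg by metis
  then have "adj w * w = 0" using cpos_swap cpos_antisym pos_neg by blast
  then have "a * n * n = 0" using neg rn by simp
  \<comment> \<open>By \<open>a^2 = x^2\<close>. Multiplying by \<open>n\<close> gives
    \<open>n^3 = 2 a n^2 = 0\<close>; a selfadjoint nilpotent element vanishes by the C*-identity,
    so \<open>x = a\<close> is positive.\<close>
  moreover have "n * n = scaleR 2 (a * n)"
    unfolding n_def by (simp add: algebra_simps a(2) ax scaleR_2)
  ultimately have "(n * n) * n = 0" by simp
  then have "(n * n) * (n * n) = 0" by (metis mult.assoc mult_zero_left)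
  then have "n = 0"
    using norm_square_selfadjoint[of "n * n"] norm_square_selfadjoint[OF san] san by (simp add: adj_mult)
  then show ?thesis using a(1) by (simp add: n_def x_def)
qed

text \<open>The circle relation of \<open>adj x * x\<close> is algebraic, so \<open>\<phi>\<close>
  carries it over, and the circle estimate applies in the target.\<close>

lemma unital_star_hom_norm_le:
  fixes \<phi> :: "'a::cstar_algebra_1 \<Rightarrow> 'b::cstar_algebra_1"
  assumes add: "\<And>x y. \<phi> (x + y) = \<phi> x + \<phi> y"
    and mult: "\<And>x y. \<phi> (x * y) = \<phi> x * \<phi> y"
    and adj: "\<And>x. \<phi> (adj x) = adj (\<phi> x)"
    and real: "\<And>r. \<phi> (of_real r) = of_real r"
  shows "norm (\<phi> x) \<le> norm x"
proof -
  define k where "k = adj x * x"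
  have sak: "adj k = k" by (simp add: k_def adj_mult adj_adj)
  obtain m where m: "adj m = m" "k * m = m * k" "k * k + m * m = of_real ((norm k)\<^sup>2)"
    using selfadjoint_circle_complement[OF sak] by blast
  have "(norm (\<phi> k))\<^sup>2 \<le> (norm k)\<^sup>2"
    by (rule unit_circle_bound[of "\<phi> k" "\<phi> m"])
      (use m sak in \<open>simp_all flip: add mult adj real\<close>)
  then have "norm (\<phi> k) \<le> norm k" by simp
  then have "(norm (\<phi> x))\<^sup>2 \<le> (norm x)\<^sup>2" by (simp add: k_def mult adj cstar_identity)
  then show ?thesis by simp
qed

section \<open>Powers of \<open>1 - h\<close> for a positive contraction \<open>h\<close>\<close>

lemma cpos_one_minus_power:
  fixes h :: "'a::cstar_algebra_1"
  assumes h: "cpos h" "norm h \<le> 1"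
  shows "cpos ((1 - h) ^ n)"
proof -
  have "cpos (of_real (norm h) - h + of_real (1 - norm h))"
    using h by (intro cpos_add cpos_norm_diff cpos_of_real) (auto simp: cpos_adj)
  then have T: "cpos (1 - h)" by simp
  show ?thesis
  proof (induction n)
    case 0 show ?case using cpos_of_real[of 1] by simp
  next
    case (Suc n)
    then show ?case using cpos_mult_commute[OF T Suc] by (simp add: power_commutes)
  qed
qed

text \<open>Operator form of \<open>(1 + n h) (1 - h)^n \<le> 1\<close>: from \<open>n\<close> to
  \<open>Suc n\<close> the left side drops by the positive element
  \<open>(n + 1) h^2 (1 - h)^n\<close>. Discarding \<open>(1 - h)^n\<close> leaves the bound on
  \<open>n h (1 - h)^n\<close>.\<close>

lemma mult_one_minus_power_bound:
  fixes h :: "'a::cstar_algebra_1"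
  assumes h: "cpos h" "norm h \<le> 1"
  shows "real n * norm (h * (1 - h) ^ n) \<le> 1"
proof -
  define T where "T = 1 - h"
  have T: "cpos (T ^ n)" for n unfolding T_def by (rule cpos_one_minus_power[OF h])
  have hT: "h * T ^ n = T ^ n * h" for n
    by (rule power_commuting_commutes[symmetric]) (simp add: T_def algebra_simps)
  have hhT: "h * h * T ^ n = T ^ n * (h * h)" for n by (metis hT mult.assoc)
  have hTpos: "cpos (h * T ^ n)" for n by (rule cpos_mult_commute[OF h(1) T hT])
  have hhTpos: "cpos (h * h * T ^ n)" for n
    by (rule cpos_mult_commute[OF cpos_square T hhT]) (simp add: h cpos_adj)
  have "cpos (1 - (T ^ n + scaleR (real n) (h * T ^ n)))"
  proof (induction n)
    case 0 show ?case using cpos_zero by simp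
  next
    case (Suc n)
    have T_Suc: "T ^ Suc n = T ^ n - h * T ^ n" by (simp add: T_def algebra_simps)
    have eq: "1 - (T ^ Suc n + scaleR (real (Suc n)) (h * T ^ Suc n)) =
      1 - (T ^ n + scaleR (real n) (h * T ^ n)) + scaleR (real (Suc n)) (h * h * T ^ n)"
      unfolding T_Suc by (simp add: algebra_simps)
    show ?case unfolding eq by (intro cpos_add cpos_scaleR hhTpos Suc) simp
  qed
  from cpos_add[OF this T[of n]] have "cpos (of_real 1 - scaleR (real n) (h * T ^ n))" by simp
  then have "norm (scaleR (real n) (h * T ^ n)) \<le> 1"
    by (intro cpos_norm_le cpos_scaleR hTpos) auto
  then show ?thesis by (simp add: T_def)
qed


section \<open>Unitization\<close>

datatype 'a unitization = Unitization (alg_part: 'a) (scalar_part: complex)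

text \<open>Left multiplication by the formal sum of algebra part and scalar part, restricted to the
  ideal; its operator norm is the source of the norm on the unitization.\<close>

definition unit_act :: "'a::cstar_algebra unitization \<Rightarrow> 'a \<Rightarrow> 'a" where
  "unit_act u x = alg_part u * x + cscale (scalar_part u) x"

lemma cscale_scaleR: "cscale c (scaleR r x) = scaleR r (cscale c (x::'a::cstar_algebra))"
  by (simp add: cscale_cscale mult.commute flip: cscale_of_real)

lemma cscale_scaleR_left: "cscale (scaleR r c) x = scaleR r (cscale c (x::'a::cstar_algebra))"
  by (simp add: scaleR_conv_of_real cscale_of_real flip: cscale_cscale)

lemma bounded_linear_cscale: "bounded_linear (cscale c :: 'a::cstar_algebra \<Rightarrow> 'a)"
  by (rule bounded_linear_intro[where K = "cmod c"])
    (auto simp: cscale_add_right cscale_scaleR norm_cscale)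

lemma bounded_linear_unit_act: "bounded_linear (unit_act u)"
  unfolding unit_act_def
  by (intro bounded_linear_add bounded_linear_mult_right bounded_linear_cscale)

instantiation unitization :: (cstar_algebra) real_algebra_1
begin

definition "0 = Unitization 0 0"
definition "1 = Unitization 0 1"
definition "u + v = Unitization (alg_part u + alg_part v) (scalar_part u + scalar_part v)"
definition "- u = Unitization (- alg_part u) (- scalar_part u)"
definition "u - v = Unitization (alg_part u - alg_part v) (scalar_part u - scalar_part v)"
definition "u * v = Unitization
  (alg_part u * alg_part v + cscale (scalar_part u) (alg_part v) + cscale (scalar_part v) (alg_part u))
  (scalar_part u * scalar_part v)"
definition "scaleR r u = Unitization (scaleR r (alg_part u)) (scaleR r (scalar_part u))"

lemma unitization_parts [simp]:
  "alg_part (0 :: 'a unitization) = 0" "scalar_part (0 :: 'a unitization) = 0"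
  "alg_part (1 :: 'a unitization) = 0" "scalar_part (1 :: 'a unitization) = 1"
  "alg_part (u + v :: 'a unitization) = alg_part u + alg_part v"
  "scalar_part (u + v) = scalar_part u + scalar_part v"
  "alg_part (- u) = - alg_part u" "scalar_part (- u) = - scalar_part u"
  "alg_part (u - v) = alg_part u - alg_part v"
  "scalar_part (u - v) = scalar_part u - scalar_part v"
  "alg_part (u * v) = alg_part u * alg_part v + cscale (scalar_part u) (alg_part v)
     + cscale (scalar_part v) (alg_part u)"
  "scalar_part (u * v) = scalar_part u * scalar_part v"
  "alg_part (scaleR r u) = scaleR r (alg_part u)"
  "scalar_part (scaleR r u) = scaleR r (scalar_part u)"
  by (simp_all add: zero_unitization_def one_unitization_def plus_unitization_def
      uminus_unitization_def minus_unitization_def times_unitization_def scaleR_unitization_def)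

instance
proof
  show "(0 :: 'a unitization) \<noteq> 1"
    by (metis unitization_parts(2,4) zero_neq_one)
qed (auto intro!: unitization.expand
      simp: algebra_simps cscale_add_left cscale_add_right cscale_cscale cscale_scaleR
        cscale_scaleR_left cscale_mult_left[symmetric] cscale_mult_right[symmetric])

end

lemma unit_act_simps:
  "unit_act 0 x = 0" "unit_act 1 x = x"
  "unit_act (u + v) x = unit_act u x + unit_act v x"
  "unit_act (u * v) x = unit_act u (unit_act v x)"
  "unit_act (scaleR r u) x = scaleR r (unit_act u x)"
  by (simp_all add: unit_act_def algebra_simps cscale_add_left cscale_add_right cscale_cscale
      cscale_scaleR cscale_scaleR_left cscale_mult_left[symmetric] cscale_mult_right[symmetric])

text \<open>The operator norm alone is only a seminorm if the algebra already has a unit, hence the maximum.\<close>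

instantiation unitization :: (cstar_algebra) real_normed_vector
begin

definition "norm u = max (onorm (unit_act u)) (cmod (scalar_part u))"
definition "sgn u = scaleR (inverse (norm u)) (u :: 'a unitization)"
definition "dist u v = norm (u - v :: 'a unitization)"
definition "(uniformity :: ('a unitization \<times> 'a unitization) filter)
  = (INF e\<in>{0 <..}. principal {(x, y). dist x y < e})"
definition "open (U :: 'a unitization set)
  = (\<forall>x\<in>U. \<forall>\<^sub>F (x', y) in uniformity. x' = x \<longrightarrow> y \<in> U)"

lemma unit_act_norm_le: "norm (unit_act u x) \<le> norm u * norm (x :: 'a)"
proof -
  have "norm (unit_act u x) \<le> onorm (unit_act u) * norm x"
    by (rule onorm[OF bounded_linear_unit_act])
  also have "\<dots> \<le> norm u * norm x"
    by (rule mult_right_mono) (auto simp: norm_unitization_def)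
  finally show ?thesis .
qed

lemma scalar_part_norm_le: "cmod (scalar_part u) \<le> norm (u :: 'a unitization)"
  by (simp add: norm_unitization_def)

lemma unitization_norm_le:
  assumes "\<And>x. norm (unit_act u x) \<le> B * norm (x :: 'a)" "cmod (scalar_part u) \<le> B"
  shows "norm u \<le> B"
  using assms onorm_bound[of B "unit_act u"] order_trans[OF norm_ge_zero assms(2)]
  by (simp add: norm_unitization_def)

text \<open>Evaluation of \<open>unit_act u\<close> at the adjoint of the algebra part, with the
  scalar term subtracted. This gives definiteness of the norm and half of the comparison used for
  completeness.\<close>

lemma alg_part_norm_le: "norm (alg_part u :: 'a) \<le> 2 * norm u"
proof (cases "alg_part u = 0")
  case True
  have "0 \<le> norm u" by (rule order_trans[OF norm_ge_zero scalar_part_norm_le])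
  then show ?thesis using True by simp
next
  case False
  let ?a = "alg_part u"
  have "(norm ?a)\<^sup>2 = norm (?a * adj ?a)"
    using cstar_identity[of "adj ?a"] by (simp add: adj_adj)
  also have "?a * adj ?a = unit_act u (adj ?a) - cscale (scalar_part u) (adj ?a)"
    by (simp add: unit_act_def)
  also have "norm \<dots> \<le> norm (unit_act u (adj ?a)) + norm (cscale (scalar_part u) (adj ?a))"
    by (rule norm_triangle_ineq4)
  also have "\<dots> \<le> norm u * norm ?a + norm u * norm ?a"
    using unit_act_norm_le[of u "adj ?a"] scalar_part_norm_le[of u]
    by (intro add_mono) (auto simp: norm_cscale mult_right_mono)
  finally show ?thesis using False by (simp add: power2_eq_square)
qed

instance
proof
  fix u v :: "'a unitization" and r :: real
  have nonneg: "0 \<le> norm w" for w :: "'a unitization"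
    by (rule order_trans[OF norm_ge_zero scalar_part_norm_le])
  show "(norm u = 0) = (u = 0)"
  proof
    assume "norm u = 0"
    then have "alg_part u = 0" "scalar_part u = 0"
      using alg_part_norm_le[of u] scalar_part_norm_le[of u] by auto
    then show "u = 0" by (auto intro: unitization.expand)
  next
    assume "u = 0"
    then have "norm u \<le> 0" by (intro unitization_norm_le) (auto simp: unit_act_simps)
    then show "norm u = 0" using nonneg[of u] by simp
  qed
  show "norm (u + v) \<le> norm u + norm v"
  proof (rule unitization_norm_le)
    show "norm (unit_act (u + v) x) \<le> (norm u + norm v) * norm x" for x
      using norm_triangle_ineq[of "unit_act u x" "unit_act v x"]
        unit_act_norm_le[of u x] unit_act_norm_le[of v x]
      by (simp add: unit_act_simps distrib_right)
    show "cmod (scalar_part (u + v)) \<le> norm u + norm v"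
      using norm_triangle_mono[OF scalar_part_norm_le scalar_part_norm_le] by simp
  qed
  have "unit_act (scaleR r u) = (\<lambda>x. scaleR r (unit_act u x))" by (auto simp: unit_act_simps)
  then show "norm (scaleR r u) = \<bar>r\<bar> * norm u"
    by (simp add: norm_unitization_def onorm_scaleR bounded_linear_unit_act max_mult_distrib_left)
qed (simp_all add: sgn_unitization_def dist_unitization_def uniformity_unitization_def
    open_unitization_def)

end

instance unitization :: (cstar_algebra) real_normed_algebra_1
proof
  fix u v :: "'a unitization"
  show "norm (u * v) \<le> norm u * norm v"
  proof (rule unitization_norm_le)
    fix x :: 'a
    have "norm (unit_act u (unit_act v x)) \<le> norm u * norm (unit_act v x)"
      by (rule unit_act_norm_le)
    also have "\<dots> \<le> norm u * (norm v * norm x)"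
      by (intro mult_left_mono unit_act_norm_le norm_ge_zero)
    finally show "norm (unit_act (u * v) x) \<le> norm u * norm v * norm x"
      by (simp add: unit_act_simps mult.assoc)
    show "cmod (scalar_part (u * v)) \<le> norm u * norm v"
      by (simp add: norm_mult mult_mono scalar_part_norm_le)
  qed
  have "norm (1 :: 'a unitization) \<le> 1"
    by (rule unitization_norm_le) (auto simp: unit_act_simps)
  then show "norm (1 :: 'a unitization) = 1"
    using scalar_part_norm_le[of "1 :: 'a unitization"] by simp
qed

text \<open>The converse comparison: the norm is equivalent to the sum of the norms of the parts, so
  completeness can be checked part by part.\<close>

lemma norm_unitization_le_parts:
  "norm (u :: 'a::cstar_algebra unitization) \<le> norm (alg_part u) + cmod (scalar_part u)"
proof (rule unitization_norm_le)
  show "norm (unit_act u x) \<le> (norm (alg_part u) + cmod (scalar_part u)) * norm x" for x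
    using norm_triangle_mono[OF norm_mult_ineq[of "alg_part u" x]
        order_refl[of "norm (cscale (scalar_part u) x)"]]
    by (simp add: unit_act_def norm_cscale distrib_right)
qed simp

instance unitization :: (cstar_algebra) banach
proof
  fix X :: "nat \<Rightarrow> 'a unitization"
  assume X: "Cauchy X"
  have "Cauchy (\<lambda>n. alg_part (X n))"
  proof (rule metric_CauchyI)
    fix e :: real assume "e > 0"
    then obtain M where "\<And>m n. m \<ge> M \<Longrightarrow> n \<ge> M \<Longrightarrow> dist (X m) (X n) < e / 2"
      using metric_CauchyD[OF X, of "e / 2"] by auto
    moreover have "dist (alg_part (X m)) (alg_part (X n)) \<le> 2 * dist (X m) (X n)" for m n
      using alg_part_norm_le[of "X m - X n"] by (simp add: dist_norm)
    ultimately show "\<exists>M. \<forall>m\<ge>M. \<forall>n\<ge>M. dist (alg_part (X m)) (alg_part (X n)) < e"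
      by (intro exI[of _ M] allI impI) (smt (verit) field_sum_of_halves)
  qed
  moreover have "Cauchy (\<lambda>n. scalar_part (X n))"
  proof (rule metric_CauchyI)
    fix e :: real assume "e > 0"
    then obtain M where "\<And>m n. m \<ge> M \<Longrightarrow> n \<ge> M \<Longrightarrow> dist (X m) (X n) < e"
      using metric_CauchyD[OF X, of e] by auto
    moreover have "dist (scalar_part (X m)) (scalar_part (X n)) \<le> dist (X m) (X n)" for m n
      using scalar_part_norm_le[of "X m - X n"] by (simp add: dist_norm)
    ultimately show "\<exists>M. \<forall>m\<ge>M. \<forall>n\<ge>M. dist (scalar_part (X m)) (scalar_part (X n)) < e"
      by (meson order_le_less_trans)
  qed
  ultimately obtain a l where lim: "(\<lambda>n. alg_part (X n)) \<longlonglongrightarrow> a" "(\<lambda>n. scalar_part (X n)) \<longlonglongrightarrow> l"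
    by (meson Cauchy_convergent convergent_def)
  have "(\<lambda>n. norm (alg_part (X n) - a) + cmod (scalar_part (X n) - l)) \<longlonglongrightarrow> norm (a - a) + cmod (l - l)"
    by (intro tendsto_intros lim)
  then have "(\<lambda>n. norm (alg_part (X n) - a) + cmod (scalar_part (X n) - l)) \<longlonglongrightarrow> 0" by simp
  then have "(\<lambda>n. X n - Unitization a l) \<longlonglongrightarrow> 0"
    by (rule Lim_null_comparison[rotated])
      (use norm_unitization_le_parts[of "X _ - Unitization a l"] in simp)
  then show "convergent X" using LIM_zero_cancel convergent_def by blast
qed

instantiation unitization :: (cstar_algebra) cstar_algebra_1
begin

definition "cscale c u = Unitization (cscale c (alg_part u)) (c * scalar_part u)"
definition "adj u = Unitization (adj (alg_part u)) (cnj (scalar_part u))"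

lemma unitization_star_parts [simp]:
  "alg_part (cscale c u :: 'a unitization) = cscale c (alg_part u)"
  "scalar_part (cscale c u :: 'a unitization) = c * scalar_part u"
  "alg_part (adj u :: 'a unitization) = adj (alg_part u)"
  "scalar_part (adj u :: 'a unitization) = cnj (scalar_part u)"
  by (simp_all add: cscale_unitization_def adj_unitization_def)

text \<open>For the algebra-valued inner product \<open>adj x * y\<close>, the operator of
  \<open>adj u\<close> is the adjoint of the operator of \<open>u\<close>.\<close>

lemma adj_unit_act_mult: "adj (unit_act u x) * y = adj x * unit_act (adj u) (y :: 'a)"
  by (simp add: unit_act_def adj_add adj_mult adj_cscale algebra_simps
      cscale_mult_left[symmetric] cscale_mult_right[symmetric])

instance
proof
  fix a b :: complex and u v :: "'a unitization" and r :: real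
  show "cscale (a + b) u = cscale a u + cscale b u"
    "cscale a (u + v) = cscale a u + cscale a v"
    "cscale a (cscale b u) = cscale (a * b) u"
    "cscale a (u * v) = cscale a u * v"
    "cscale a (u * v) = u * cscale a v"
    "adj (u + v) = adj u + adj v"
    "adj (cscale a u) = cscale (cnj a) (adj u)"
    "adj (u * v) = adj v * adj u"
    by (rule unitization.expand; simp add: algebra_simps cscale_add_left cscale_add_right
        cscale_cscale adj_add adj_mult adj_cscale cscale_mult_left[symmetric] cscale_mult_right[symmetric])+
  show "cscale (complex_of_real r) u = scaleR r u"
    by (rule unitization.expand) (simp add: cscale_of_real scaleR_conv_of_real[where 'a = complex])
  show adj_adj: "adj (adj u) = u" for u :: "'a unitization"
    by (rule unitization.expand) (simp add: adj_adj)
  show "norm (cscale a u) = cmod a * norm u"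
  proof -
    have le: "norm (cscale c w) \<le> cmod c * norm w" for c and w :: "'a unitization"
    proof (rule unitization_norm_le)
      have "unit_act (cscale c w) x = cscale c (unit_act w x)" for x
        by (simp add: unit_act_def cscale_add_right cscale_cscale cscale_mult_left)
      then show "norm (unit_act (cscale c w) x) \<le> cmod c * norm w * norm x" for x
        by (simp add: norm_cscale mult.assoc mult_left_mono unit_act_norm_le)
    qed (simp add: norm_mult mult_left_mono scalar_part_norm_le)
    show ?thesis
    proof (cases "a = 0")
      case True then show ?thesis using le[of 0 u] by simp
    next
      case False
      have "cscale (inverse a) (cscale a u) = u"
        by (rule unitization.expand) (use False in \<open>simp add: cscale_cscale\<close>)
      then have "norm u \<le> norm (cscale a u) / cmod a"
        using le[of "inverse a" "cscale a u"] by (simp add: norm_inverse divide_inverse mult.commute)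
      then show ?thesis using le[of a u] False by (simp add: field_simps)
    qed
  qed
  \<comment> \<open>Only this inequality is computed. It makes \<open>adj\<close> isometric, and
    submultiplicativity then yields equality.\<close>
  have cstar_le: "(norm w)\<^sup>2 \<le> norm (adj w * w)" for w :: "'a unitization"
  proof -
    let ?B = "norm (adj w * w)"
    have "norm w \<le> sqrt ?B"
    proof (rule unitization_norm_le)
      fix x :: 'a
      have "(norm (unit_act w x))\<^sup>2 = norm (adj x * unit_act (adj w * w) x)"
        by (simp add: unit_act_simps flip: cstar_identity adj_unit_act_mult)
      also have "\<dots> \<le> norm x * (?B * norm x)"
        by (rule order_trans[OF norm_mult_ineq]) (simp add: mult_left_mono unit_act_norm_le)
      also have "\<dots> = (sqrt ?B * norm x)\<^sup>2" by (simp add: power2_eq_square)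
      finally show "norm (unit_act w x) \<le> sqrt ?B * norm x"
        by (rule power2_le_imp_le) simp
      have "(cmod (scalar_part w))\<^sup>2 \<le> ?B"
        using scalar_part_norm_le[of "adj w * w"] by (simp add: norm_mult power2_eq_square)
      then show "cmod (scalar_part w) \<le> sqrt ?B" by (rule real_le_rsqrt)
    qed
    then show ?thesis by (simp add: sqrt_ge_absD)
  qed
  have norm_le: "norm w \<le> norm (adj w)" for w :: "'a unitization"
  proof (cases "w = 0")
    case False
    have "norm w * norm w \<le> norm (adj w) * norm w"
      using cstar_le[of w] norm_mult_ineq[of "adj w" w] by (simp add: power2_eq_square)
    then show ?thesis using False by simp
  qed simp
  have "norm (adj u) = norm u"
    using norm_le[of u] norm_le[of "adj u"] by (simp add: adj_adj)
  then show "norm (adj u * u) = (norm u)\<^sup>2"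
    using cstar_le[of u] norm_mult_ineq[of "adj u" u] by (simp add: power2_eq_square)
qed

end

definition unit_embed :: "'a::cstar_algebra \<Rightarrow> 'a unitization" where
  "unit_embed a = Unitization a 0"

lemma unit_embed_parts [simp]:
  "alg_part (unit_embed a) = a" "scalar_part (unit_embed a) = 0"
  by (simp_all add: unit_embed_def)

lemma unit_embed_adj: "unit_embed (adj a) = adj (unit_embed a)"
  by (rule unitization.expand) simp

lemma norm_unit_embed [simp]: "norm (unit_embed a) = norm (a :: 'a::cstar_algebra)"
proof (rule antisym)
  show "norm (unit_embed a) \<le> norm a" using norm_unitization_le_parts[of "unit_embed a"] by simp
  show "norm a \<le> norm (unit_embed a)"
  proof (cases "a = 0")
    case False
    have "norm a * norm a = norm (unit_act (unit_embed a) (adj a))"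
      using cstar_identity[of "adj a"] by (simp add: unit_act_def adj_adj power2_eq_square)
    also have "\<dots> \<le> norm (unit_embed a) * norm a"
      using unit_act_norm_le[of "unit_embed a" "adj a"] by simp
    finally show ?thesis using False by simp
  qed simp
qed

text \<open>Extending \<open>\<phi>\<close> to the unitization by fixing scalars gives a unital star
  homomorphism, and the embedding is isometric.\<close>

lemma star_automorphism_norm_le:
  fixes \<phi> :: "'a::cstar_algebra \<Rightarrow> 'a"
  assumes "star_automorphism \<phi>"
  shows "norm (\<phi> x) \<le> norm x"
proof -
  have \<phi>: "\<phi> (x + y) = \<phi> x + \<phi> y" "\<phi> (cscale c x) = cscale c (\<phi> x)" "\<phi> (x * y) = \<phi> x * \<phi> y"
    "\<phi> (adj x) = adj (\<phi> x)" for x y c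
    using assms by (auto simp: star_automorphism_def)
  have \<phi>0: "\<phi> 0 = 0" using \<phi>(1)[of 0 0] by simp
  let ?\<Phi> = "\<lambda>u. Unitization (\<phi> (alg_part u)) (scalar_part u)"
  have "norm (?\<Phi> (unit_embed x)) \<le> norm (unit_embed x)"
    by (rule unital_star_hom_norm_le) (rule unitization.expand; simp add: \<phi> \<phi>0 of_real_def)+
  moreover have "?\<Phi> (unit_embed x) = unit_embed (\<phi> x)" by (simp add: unit_embed_def)
  ultimately show ?thesis by simp
qed

section \<open>Approximate units\<close>

text \<open>By the C*-identity the left side is the norm of the single term
  \<open>c (b i)^2 c\<close>. The other terms have the form \<open>adj z * z\<close>, so adding them
  cannot decrease the norm.\<close>

lemma norm_mult_square_bound:
  fixes c h :: "'a::cstar_algebra_1"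
  assumes sac: "adj c = c" and "finite S" and b: "\<And>i. i \<in> S \<Longrightarrow> adj (b i) = b i" and "i \<in> S"
  shows "(norm (c * b i))\<^sup>2 \<le> norm (c * (\<Sum>i\<in>S. b i * b i) * c)"
proof -
  have conj: "c * (b j * b j) * c = adj (b j * c) * (b j * c)" if "j \<in> S" for j
    using b[OF that] sac by (simp add: adj_mult mult.assoc)
  have "(norm (c * b i))\<^sup>2 = (norm (adj (c * b i)))\<^sup>2" by simp
  also have "\<dots> = norm (c * (b i * b i) * c)"
    unfolding conj[OF \<open>i \<in> S\<close>] cstar_identity using sac b[OF \<open>i \<in> S\<close>] by (simp add: adj_mult)
  also have "\<dots> \<le> norm (c * (\<Sum>i\<in>S. b i * b i) * c)"
  proof (rule cpos_norm_mono)
    show "cpos (c * (b i * b i) * c)" unfolding conj[OF \<open>i \<in> S\<close>] by (rule cpos_adj_mult)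
    have "c * (\<Sum>i\<in>S. b i * b i) * c - c * (b i * b i) * c
        = (\<Sum>j\<in>S - {i}. c * (b j * b j) * c)"
      using \<open>finite S\<close> \<open>i \<in> S\<close>
      by (simp add: sum_distrib_left sum_distrib_right sum_diff1)
    also have "cpos \<dots>" by (rule cpos_sum) (simp add: conj cpos_adj_mult)
    finally show "cpos (c * (\<Sum>i\<in>S. b i * b i) * c - c * (b i * b i) * c)" .
  qed
  finally show ?thesis .
qed

text \<open>For \<open>h = (\<Sum>b\<in>S. b\<^sup>2) / M\<close> of norm at most one, \<open>c = (1 - h)^n\<close> satisfies
  \<open>\<parallel>c b\<parallel>\<^sup>2 \<le> M \<parallel>h (1 - h)^(2 n)\<parallel> \<le> M / (2 n)\<close>, and \<open>1 - c\<close> lies in the algebra itself.\<close>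

lemma approximate_unit_selfadjoint:
  fixes S :: "'a::cstar_algebra set"
  assumes "finite S" and sa: "\<And>b. b \<in> S \<Longrightarrow> adj b = b" and "\<delta> > 0"
  obtains e where "adj e = e" "norm e \<le> 1" "\<And>b. b \<in> S \<Longrightarrow> norm (e * b - b) < \<delta>"
proof -
  define H where "H = (\<Sum>b\<in>S. unit_embed b * unit_embed b)"
  have sae: "adj (unit_embed b) = unit_embed b" if "b \<in> S" for b
    using sa[OF that] by (simp flip: unit_embed_adj)
  have H: "cpos H" unfolding H_def by (intro cpos_sum cpos_square sae)
  \<comment> \<open>The summand \<open>1\<close> keeps \<open>M\<close> positive when
    \<open>H = 0\<close>, and \<open>norm H \<le> M\<close> makes \<open>h\<close> a
    contraction.\<close>
  define M where "M = norm H + 1"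
  have M: "M > 0" by (simp add: M_def add_nonneg_pos)
  define h where "h = scaleR (1 / M) H"
  have h: "cpos h" "norm h \<le> 1" using H M by (auto simp: h_def cpos_scaleR M_def)
  obtain n where n: "real n > M / \<delta>\<^sup>2" using reals_Archimedean2 by blast
  then have "real n > 0" using M \<open>\<delta> > 0\<close> by (meson divide_pos_pos order_less_trans zero_less_power)
  define c where "c = (1 - h) ^ n"
  have c: "cpos c" "adj c = c"
    using cpos_one_minus_power[OF h] by (auto simp: c_def cpos_adj)
  have "norm (1 - h) \<le> 1"
    using cpos_norm_le[of "1 - h" 1] cpos_one_minus_power[OF h, of 1] h by simp
  then have "norm c \<le> 1"
    unfolding c_def by (meson norm_ge_zero norm_power_ineq order_trans power_le_one)
  then have "cpos (of_real (norm c) - c + of_real (1 - norm c))"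
    using c by (intro cpos_add cpos_norm_diff cpos_of_real) auto
  then have norm_1c: "norm (1 - c) \<le> 1" using c cpos_norm_le[of "1 - c" 1] by simp
  have "c * H * c = scaleR M (h * (1 - h) ^ (2 * n))"
  proof -
    have "(1 - h) * h = h * (1 - h)" by (simp add: algebra_simps)
    then have "c * h = h * c" unfolding c_def by (rule power_commuting_commutes)
    then have "c * h * c = h * (1 - h) ^ (2 * n)"
      by (simp add: c_def mult_2 power_add mult.assoc)
    moreover have "H = scaleR M h" using M by (simp add: h_def)
    ultimately show ?thesis by simp
  qed
  then have "norm (c * H * c) = M * norm (h * (1 - h) ^ (2 * n))" using M by simp
  moreover have "norm (h * (1 - h) ^ (2 * n)) \<le> 1 / real (2 * n)"
    using mult_one_minus_power_bound[OF h, of "2 * n"] \<open>real n > 0\<close> by (simp add: field_simps)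
  ultimately have "norm (c * H * c) \<le> M / real (2 * n)"
    using M mult_left_mono[of _ "1 / real (2 * n)" M] by simp
  also have "\<dots> < \<delta>\<^sup>2"
  proof -
    have "M < real n * \<delta>\<^sup>2" using n \<open>\<delta> > 0\<close> by (simp add: field_simps)
    also have "\<dots> < real (2 * n) * \<delta>\<^sup>2" using \<open>real n > 0\<close> \<open>\<delta> > 0\<close> by simp
    finally show ?thesis using \<open>real n > 0\<close> by (simp add: pos_divide_less_eq mult.commute)
  qed
  finally have cHc: "norm (c * H * c) < \<delta>\<^sup>2" .
  have small: "norm (c * unit_embed b) < \<delta>" if "b \<in> S" for b
  proof -
    have "(norm (c * unit_embed b))\<^sup>2 < \<delta>\<^sup>2"
      using norm_mult_square_bound[of c S unit_embed b, OF c(2) \<open>finite S\<close> sae that] cHc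
      by (simp add: H_def)
    then show ?thesis by (rule power_less_imp_less_base) (use \<open>\<delta> > 0\<close> in simp)
  qed
  \<comment> \<open>Since \<open>h\<close> has scalar part \<open>0\<close>, every power of
    \<open>1 - h\<close> has scalar part \<open>1\<close>, which cancels in
    \<open>1 - c\<close>.\<close>
  have "scalar_part (\<Sum>b\<in>A. unit_embed b * unit_embed b) = 0" for A :: "'a set"
    by (induction A rule: infinite_finite_induct) auto
  then have "scalar_part h = 0" by (simp add: h_def H_def)
  then have "scalar_part ((1 - h) ^ k) = 1" for k by (induction k) auto
  then have e: "unit_embed (alg_part (1 - c)) = 1 - c"
    by (intro unitization.expand) (simp add: c_def)
  show ?thesis
  proof (rule that)
    have "adj (1 - c) = 1 - c" using c by (simp add: adj_diff)
    then show "adj (alg_part (1 - c)) = alg_part (1 - c)"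
      by (metis unitization_star_parts(3))
    show "norm (alg_part (1 - c)) \<le> 1" using norm_1c norm_unit_embed e by metis
    show "norm (alg_part (1 - c) * b - b) < \<delta>" if "b \<in> S" for b
    proof -
      have "unit_embed (alg_part (1 - c) * b - b) = unit_embed (alg_part (1 - c)) * unit_embed b - unit_embed b"
        by (rule unitization.expand) simp
      also have "\<dots> = - (c * unit_embed b)" unfolding e by (simp add: algebra_simps)
      finally show ?thesis using small[OF that] by (metis norm_minus_cancel norm_unit_embed)
    qed
  qed
qed

text \<open>Real and imaginary parts are approximated to \<open>\<delta> / 2\<close> each. They also
  serve \<open>adj x\<close>, and taking adjoints turns its left estimate into the right estimate
  for \<open>x\<close>.\<close>

lemma approximate_unit:
  fixes S :: "'a::cstar_algebra set"
  assumes "finite S" "\<delta> > 0"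
  obtains e where "adj e = e" "norm e \<le> 1"
    "\<And>x. x \<in> S \<Longrightarrow> norm (e * x - x) < \<delta>" "\<And>x. x \<in> S \<Longrightarrow> norm (x * e - x) < \<delta>"
proof -
  have "\<exists>s t. adj s = s \<and> adj t = t \<and> x = s + cscale \<i> t" for x :: 'a
    using selfadjoint_decomposition by metis
  then obtain s t where st: "\<And>x::'a. adj (s x) = s x" "\<And>x. adj (t x) = t x"
    "\<And>x. s x + cscale \<i> (t x) = x"
    by metis
  have sa: "adj b = b" if "b \<in> s ` S \<union> t ` S" for b using that st(1,2) by auto
  obtain e where e: "adj e = e" "norm e \<le> 1"
    "\<And>b. b \<in> s ` S \<union> t ` S \<Longrightarrow> norm (e * b - b) < \<delta> / 2"
    by (rule approximate_unit_selfadjoint[of "s ` S \<union> t ` S" "\<delta> / 2"]) (use assms sa in auto)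
  have left: "norm (e * (a + cscale z b) - (a + cscale z b)) < \<delta>"
    if "norm (e * a - a) < \<delta> / 2" "norm (e * b - b) < \<delta> / 2" "cmod z = 1" for a b z
  proof -
    have "e * (a + cscale z b) - (a + cscale z b) = (e * a - a) + cscale z (e * b - b)"
      by (simp add: algebra_simps cscale_diff_right flip: cscale_mult_right)
    also have "norm \<dots> \<le> norm (e * a - a) + norm (e * b - b)"
      using norm_triangle_ineq[of "e * a - a" "cscale z (e * b - b)"] that(3)
      by (simp add: norm_cscale)
    finally show ?thesis using that by linarith
  qed
  show ?thesis
  proof (rule that[OF e(1,2)])
    fix x assume x: "x \<in> S"
    then have b: "norm (e * s x - s x) < \<delta> / 2" "norm (e * t x - t x) < \<delta> / 2" using e(3) by auto
    show "norm (e * x - x) < \<delta>" using left[OF b, of \<i>] by (simp add: st(3))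
    have "adj x = s x + cscale (- \<i>) (t x)"
      using arg_cong[OF st(3)[of x], of adj] by (simp add: adj_add adj_cscale st(1,2))
    then have "norm (e * adj x - adj x) < \<delta>" using left[OF b, of "- \<i>"] by (simp del: cscale_minus_left)
    moreover have "e * adj x - adj x = adj (x * e - x)" by (simp add: adj_diff adj_mult e(1))
    ultimately show "norm (x * e - x) < \<delta>" by simp
  qed
qed


section \<open>Compressing multipliers into the algebra\<close>

text \<open>The supremum in \<open>onorm\<close> is an upper bound only for bounded linear maps, so
  each tower condition below is preceded by a proof of boundedness.\<close>

lemma mnorm_bound:
  "bounded_linear (fst x) \<Longrightarrow> norm (fst x a) \<le> mnorm x * norm (a::'a::cstar_algebra)"
  unfolding mnorm_def by (rule onorm)

lemma mpositive_contraction_norm_le: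
  assumes "mpositive_contraction (x :: 'a::cstar_algebra mult)"
  shows "norm (fst x a) \<le> norm a"
proof -
  have "norm (fst x a) \<le> mnorm x * norm a"
    using assms by (intro mnorm_bound double_centralizer_bounded_linear)
      (simp add: mpositive_contraction_def)
  also have "\<dots> \<le> 1 * norm a"
    using assms by (intro mult_right_mono) (auto simp: mpositive_contraction_def)
  finally show ?thesis by simp
qed

definition compress :: "'a::cstar_algebra \<Rightarrow> 'a mult \<Rightarrow> 'a" where
  "compress e x = e * fst x e"

lemma compress_positive_contraction:
  fixes e :: "'a::cstar_algebra"
  assumes x: "mpositive_contraction x" and e: "adj e = e" "norm e \<le> 1"
  shows "positive_contraction (compress e x)"
proof -
  obtain y where y: "double_centralizer y" "x = mmult (madj y) y"
    using x by (auto simp: mpositive_contraction_def)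
  have "compress e x = adj (snd y (adj (fst y e)) * e)"
    by (simp add: compress_def y(2) mmult_def madj_def adj_mult e(1))
  also have "\<dots> = adj (fst y e) * fst y e"
    by (simp add: double_centralizerD[OF y(1), symmetric] adj_mult adj_adj)
  finally have "\<exists>z. compress e x = adj z * z" by blast
  moreover have "norm (compress e x) \<le> 1"
  proof -
    have "norm (compress e x) \<le> norm e * norm (fst x e)"
      unfolding compress_def by (rule norm_mult_ineq)
    also have "\<dots> \<le> 1 * 1"
      using mpositive_contraction_norm_le[OF x, of e] e(2) by (intro mult_mono) auto
    finally show ?thesis by simp
  qed
  ultimately show ?thesis by (simp add: positive_contraction_def)
qed

lemma norm_mult_left_contraction:
  fixes x :: "'a::real_normed_algebra"
  assumes "norm e \<le> 1" shows "norm (e * x) \<le> norm x"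
  using norm_mult_ineq[of e x] mult_right_mono[OF assms, of "norm x"] by simp

lemma norm_mult_right_contraction:
  fixes x :: "'a::real_normed_algebra"
  assumes "norm e \<le> 1" shows "norm (x * e) \<le> norm x"
  using norm_mult_ineq[of x e] mult_left_mono[OF assms, of "norm x"] by simp

text \<open>Two errors of size \<open>\<delta>\<close>: one from replacing \<open>e a\<close> by
  \<open>a\<close> inside the contraction \<open>fst x\<close>, one from dropping the outer
  \<open>e\<close>.\<close>

lemma compress_mult_left:
  fixes e :: "'a::cstar_algebra"
  assumes x: "mpositive_contraction x" and e: "norm e \<le> 1"
    and "norm (e * a - a) \<le> \<delta>" "norm (e * fst x a - fst x a) \<le> \<delta>"
  shows "norm (compress e x * a - fst x a) \<le> 2 * \<delta>"
proof -
  have dc: "double_centralizer x" using x by (simp add: mpositive_contraction_def)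
  have "compress e x * a = e * fst x (e * a)"
    by (simp add: compress_def double_centralizer_mult_right[OF dc] mult.assoc)
  also have "\<dots> = e * fst x (e * a - a) + e * fst x a"
    by (simp add: linear_diff[OF bounded_linear.linear[OF double_centralizer_bounded_linear[OF dc]]]
        algebra_simps)
  finally have eq: "compress e x * a - fst x a = e * fst x (e * a - a) + (e * fst x a - fst x a)"
    by simp
  have "norm (e * fst x (e * a - a)) \<le> \<delta>"
    using norm_mult_left_contraction[OF e, of "fst x (e * a - a)"]
      mpositive_contraction_norm_le[OF x, of "e * a - a"] assms(3) by linarith
  then show ?thesis unfolding eq mult_2 by (rule norm_triangle_mono[OF _ assms(4)])
qed

text \<open>The mirror image: once \<open>a e\<close> is replaced by \<open>a\<close>, the identity
  \<open>a * fst x e = snd x a * e\<close> exposes the second use of \<open>e\<close>.\<close>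

lemma compress_mult_right:
  fixes e :: "'a::cstar_algebra"
  assumes x: "mpositive_contraction x" and e: "norm e \<le> 1"
    and "norm (a * e - a) \<le> \<delta>" "norm (snd x a * e - snd x a) \<le> \<delta>"
  shows "norm (a * compress e x - snd x a) \<le> 2 * \<delta>"
proof -
  have dc: "double_centralizer x" using x by (simp add: mpositive_contraction_def)
  have eq: "a * compress e x - snd x a = (a * e - a) * fst x e + (snd x a * e - snd x a)"
    by (simp add: compress_def algebra_simps double_centralizerD[OF dc, of a e])
  have "norm ((a * e - a) * fst x e) \<le> \<delta>"
    using norm_mult_right_contraction[of "fst x e" "a * e - a"]
      mpositive_contraction_norm_le[OF x, of e] e assms(3) by linarith
  then show ?thesis unfolding eq mult_2 by (rule norm_triangle_mono[OF _ assms(4)])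
qed

lemma compress_compress_mult_left:
  fixes e :: "'a::cstar_algebra"
  assumes x: "mpositive_contraction x" and y: "mpositive_contraction y"
    and e: "adj e = e" "norm e \<le> 1"
    and "norm (e * a - a) \<le> \<delta>" "norm (e * fst y a - fst y a) \<le> \<delta>"
      "norm (e * fst x (fst y a) - fst x (fst y a)) \<le> \<delta>"
  shows "norm (compress e x * compress e y * a - fst x (fst y a)) \<le> 4 * \<delta>"
proof -
  have "norm (compress e x * (compress e y * a - fst y a)) \<le> 2 * \<delta>"
    using norm_mult_left_contraction[of "compress e x" "compress e y * a - fst y a"]
      compress_positive_contraction[OF x e] compress_mult_left[OF y e(2) assms(5,6)]
    by (simp add: positive_contraction_def)
  then have "norm (compress e x * (compress e y * a - fst y a)
      + (compress e x * fst y a - fst x (fst y a))) \<le> 2 * \<delta> + 2 * \<delta>"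
    by (rule norm_triangle_mono) (rule compress_mult_left[OF x e(2) assms(6,7)])
  then show ?thesis by (simp add: algebra_simps)
qed

lemma norm_le_if_mult_right_le:
  fixes z :: "'a::cstar_algebra"
  assumes "\<And>b. norm (z * b) \<le> \<eta> * norm b" "0 \<le> \<eta>"
  shows "norm z \<le> \<eta>"
proof (cases "z = 0")
  case False
  have "norm z * norm z \<le> \<eta> * norm z"
    using assms(1)[of "adj z"] cstar_identity[of "adj z"] by (simp add: adj_adj power2_eq_square)
  then show ?thesis using False by simp
qed (use assms in simp)

text \<open>The commutator of a multiplier with \<open>a\<close> is left multiplication by the
  algebra element \<open>fst x a - snd x a\<close>, whose norm is recovered from that
  operator.\<close>

lemma mcomm_membed_norm_le:
  fixes x :: "'a::cstar_algebra mult"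
  assumes dc: "double_centralizer x" and less: "mnorm (mcomm x (membed a)) < \<eta>"
  shows "norm (fst x a - snd x a) \<le> \<eta>"
proof (rule norm_le_if_mult_right_le)
  let ?c = "mcomm x (membed a)"
  have L: "bounded_linear (fst x)" by (rule double_centralizer_bounded_linear[OF dc])
  have fst: "fst ?c = (\<lambda>b. fst x (a * b) - a * fst x b)"
    by (auto simp: mcomm_def mdiff_def mmult_def membed_def)
  have bl: "bounded_linear (fst ?c)"
    unfolding fst
    by (intro bounded_linear_sub bounded_linear_compose[OF L] bounded_linear_mult_right
        bounded_linear_compose[OF bounded_linear_mult_right L])
  show "norm ((fst x a - snd x a) * b) \<le> \<eta> * norm b" for b
  proof -
    have "(fst x a - snd x a) * b = fst ?c b"
      unfolding fst by (simp add: left_diff_distrib double_centralizer_mult_right[OF dc]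
          double_centralizerD[OF dc])
    also have "norm \<dots> \<le> mnorm ?c * norm b" by (rule mnorm_bound[OF bl])
    also have "\<dots> \<le> \<eta> * norm b" using less by (intro mult_right_mono) auto
    finally show ?thesis .
  qed
  show "0 \<le> \<eta>" using less onorm_pos_le[OF bl] by (simp add: mnorm_def)
qed

section \<open>From multiplier towers to towers\<close>

lemma star_automorphism_bounded_linear:
  assumes "star_automorphism (\<phi> :: 'a::cstar_algebra \<Rightarrow> 'a)"
  shows "bounded_linear \<phi>"
proof (rule bounded_linear_intro[where K = 1])
  show "\<phi> (scaleR r x) = scaleR r (\<phi> x)" for r x
    using assms unfolding star_automorphism_def by (metis cscale_of_real)
qed (use assms star_automorphism_norm_le in \<open>auto simp: star_automorphism_def\<close>)

lemma rokhlin_dim_le_if_mult_rokhlin_dim_le: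
  fixes \<beta> :: "'g \<Rightarrow> 'a::cstar_algebra \<Rightarrow> 'a"
  assumes G: "group G" and fin: "finite (lcoset_space G K)" and act: "cstar_action G \<beta>"
    and dim: "mult_rokhlin_dim_le comm G K \<beta> d"
  shows "rokhlin_dim_le comm G K \<beta> d"
  unfolding rokhlin_dim_le_def
proof (intro allI impI)
  fix \<epsilon> :: real and M :: "'g set" and F :: "'a set"
  assume "\<epsilon> > 0" and MF: "finite M \<and> M \<subseteq> carrier G \<and> finite F"
  define P where "P = lcoset_space G K"
  define I where "I = {..d} \<times> P"
  have finI: "finite I" using fin by (simp add: I_def P_def)
  define B where "B = 1 + (\<Sum>a\<in>F. norm a)"
  have "B \<ge> 1" by (simp add: B_def sum_nonneg)
  have aB: "norm a \<le> B" if "a \<in> F" for a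
    using member_le_sum[OF that, of norm] MF by (simp add: B_def)
  \<comment> \<open>Errors below \<open>\<eta>\<close> in multiplier norm become at most
    \<open>\<epsilon> / 2\<close> at each \<open>a\<close> in \<open>F\<close>, as
    \<open>norm a \<le> B\<close>. The commutator with \<open>a\<close> contributes
    \<open>\<eta>\<close> undivided, so \<open>B \<ge> 1\<close> is arranged to get
    \<open>\<eta> \<le> \<epsilon> / 2\<close>.\<close>
  define \<eta> where "\<eta> = \<epsilon> / (2 * B)"
  have \<eta>: "\<eta> > 0" "\<eta> \<le> \<epsilon> / 2"
    using \<open>\<epsilon> > 0\<close> \<open>B \<ge> 1\<close> by (auto simp: \<eta>_def field_simps)
  have \<eta>a: "r * norm a \<le> \<epsilon> / 2" if "a \<in> F" "r < \<eta>" for a r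
  proof -
    have "r * norm a \<le> \<eta> * B"
      using aB[OF that(1)] that(2) \<eta> by (intro mult_mono) auto
    also have "\<dots> = \<epsilon> / 2" using \<open>B \<ge> 1\<close> by (simp add: \<eta>_def)
    finally show ?thesis .
  qed
  \<comment> \<open>The sum over \<open>I\<close> collects \<open>card I\<close> errors of
    \<open>2 * \<delta>\<close>, and the commuting-tower condition collects
    \<open>8 * \<delta>\<close>, the largest of the others; \<open>9\<close> instead of
    \<open>8\<close> keeps both inequalities strict.\<close>
  define \<delta> where "\<delta> = \<epsilon> / (2 * (2 * real (card I) + 9))"
  have \<delta>: "\<delta> > 0" "8 * \<delta> < \<epsilon> / 2" "real (card I) * (2 * \<delta>) < \<epsilon> / 2"
    using \<open>\<epsilon> > 0\<close> by (auto simp: \<delta>_def field_simps intro: add_pos_nonneg)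
  obtain f where "mult_rokhlin_towers comm G K \<beta> d \<eta> M F f"
    using dim MF \<eta> unfolding mult_rokhlin_dim_le_def by blast
  note towers = this[unfolded mult_rokhlin_towers_def, folded P_def, folded I_def]
  have pos: "mpositive_contraction (f l C)" if "l \<le> d" "C \<in> P" for l C
    using towers that by simp
  have orth: "mnorm (mmult (f l C) (f l D)) < \<eta>"
    if "l \<le> d" "C \<in> P" "D \<in> P" "C \<noteq> D" for l C D
    using towers that by simp
  have unit: "mnorm (mdiff (msum (\<lambda>(l, C). f l C) I) munit) < \<eta>"
    using towers by simp
  have equi: "mnorm (mdiff (maction G \<beta> h (f l (g <#\<^bsub>G\<^esub> K))) (f l ((h \<otimes>\<^bsub>G\<^esub> g) <#\<^bsub>G\<^esub> K))) < \<eta>"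
    if "l \<le> d" "g \<in> carrier G" "h \<in> M" for l g h
    using towers that by simp
  have central: "mnorm (mcomm (f l C) (membed a)) < \<eta>" if "l \<le> d" "C \<in> P" "a \<in> F" for l C a
    using towers that by simp
  have commuting: "mnorm (mcomm (f l C) (f k D)) < \<eta>"
    if comm "k \<le> d" "l \<le> d" "C \<in> P" "D \<in> P" for k l C D
    using towers that by simp
  have dc: "double_centralizer (f l C)" if "l \<le> d" "C \<in> P" for l C
    using pos[OF that] by (simp add: mpositive_contraction_def)
  have bl: "bounded_linear (fst (f l C))" if "l \<le> d" "C \<in> P" for l C
    by (rule double_centralizer_bounded_linear[OF dc[OF that]])
  have aut: "star_automorphism (\<beta> g)" if "g \<in> carrier G" for g
    using act that by (simp add: cstar_action_def)
  have bl\<beta>: "bounded_linear (\<beta> g)" if "g \<in> carrier G" for g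
    by (rule star_automorphism_bounded_linear[OF aut[OF that]])
  have coset: "g <#\<^bsub>G\<^esub> K \<in> P" if "g \<in> carrier G" for g
    using that by (auto simp: P_def lcoset_space_def)

  \<comment> \<open>The translates in \<open>A0\<close> serve equivariance, \<open>A1\<close> single
    products with a tower element, \<open>A2\<close> products of two, and \<open>A3\<close>
    multiplication from the right.\<close>
  define A0 where "A0 = F \<union> (\<Union>g\<in>M. \<beta> (inv\<^bsub>G\<^esub> g) ` F)"
  define A1 where "A1 = (\<Union>(l, C)\<in>I. fst (f l C) ` A0)"
  define A2 where "A2 = (\<Union>(l, C)\<in>I. fst (f l C) ` A1)"
  define A3 where "A3 = (\<Union>(l, C)\<in>I. snd (f l C) ` F)"
  have fin0: "finite A0" unfolding A0_def using MF by auto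
  then have fin1: "finite A1" unfolding A1_def using finI by auto
  then have fin2: "finite A2" unfolding A2_def using finI by auto
  have fin3: "finite A3" unfolding A3_def using finI MF by auto
  obtain e where e: "adj e = e" "norm e \<le> 1"
    and le: "\<And>x. x \<in> A0 \<union> A1 \<union> A2 \<union> A3 \<Longrightarrow> norm (e * x - x) < \<delta>"
    and re: "\<And>x. x \<in> A0 \<union> A1 \<union> A2 \<union> A3 \<Longrightarrow> norm (x * e - x) < \<delta>"
    by (rule approximate_unit[of "A0 \<union> A1 \<union> A2 \<union> A3" \<delta>]) (use \<delta>(1) fin0 fin1 fin2 fin3 in auto)
  define f' where "f' l C = compress e (f l C)" for l C

  have A1: "fst (f l C) a \<in> A1" if "l \<le> d" "C \<in> P" "a \<in> A0" for l C a
    using that by (force simp: A1_def I_def)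
  have A2: "fst (f l C) a \<in> A2" if "l \<le> d" "C \<in> P" "a \<in> A1" for l C a
    using that by (force simp: A2_def I_def)
  have A3: "snd (f l C) a \<in> A3" if "l \<le> d" "C \<in> P" "a \<in> F" for l C a
    using that by (force simp: A3_def I_def)
  have one: "norm (f' l C * a - fst (f l C) a) \<le> 2 * \<delta>" if "l \<le> d" "C \<in> P" "a \<in> A0" for l C a
    unfolding f'_def using that
    by (intro compress_mult_left pos e less_imp_le[OF le]) (auto simp: A1)
  have two: "norm (f' l C * f' k D * a - fst (f l C) (fst (f k D) a)) \<le> 4 * \<delta>"
    if "l \<le> d" "C \<in> P" "k \<le> d" "D \<in> P" "a \<in> A0" for l k C D a
    unfolding f'_def using that
    by (intro compress_compress_mult_left pos e less_imp_le[OF le])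
      (auto simp: A1 A2)
  have FA0: "a \<in> A0" if "a \<in> F" for a using that by (simp add: A0_def)

  have "rokhlin_towers comm G K \<beta> d \<epsilon> M F f'"
    unfolding rokhlin_towers_def P_def[symmetric] I_def[symmetric]
  proof (intro conjI ballI allI impI)
    show "positive_contraction (f' l C)" if "l \<le> d" "C \<in> P" for l C
      unfolding f'_def by (rule compress_positive_contraction[OF pos[OF that] e])
  next
    fix a assume a: "a \<in> F"
    let ?s = "mdiff (msum (\<lambda>(l, C). f l C) I) munit"
    have fst: "fst ?s = (\<lambda>x. (\<Sum>i\<in>I. fst (f (fst i) (snd i)) x) - x)"
      by (auto simp: mdiff_def msum_def munit_def case_prod_beta)
    have "bounded_linear (fst ?s)"
      unfolding fst by (intro bounded_linear_sub bounded_linear_sum bounded_linear_ident bl)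
        (auto simp: I_def)
    from order_trans[OF mnorm_bound[OF this] \<eta>a[OF a unit]]
    have s: "norm (fst ?s a) \<le> \<epsilon> / 2" .
    have "norm (\<Sum>i\<in>I. f' (fst i) (snd i) * a - fst (f (fst i) (snd i)) a)
        \<le> real (card I) * (2 * \<delta>)"
      by (rule sum_norm_bound) (use one FA0[OF a] in \<open>auto simp: I_def\<close>)
    then have "norm (\<Sum>i\<in>I. f' (fst i) (snd i) * a - fst (f (fst i) (snd i)) a) < \<epsilon> / 2"
      using \<delta>(3) by linarith
    moreover have "(\<Sum>(l, C)\<in>I. f' l C) * a - a
        = (\<Sum>i\<in>I. f' (fst i) (snd i) * a - fst (f (fst i) (snd i)) a) + fst ?s a"
      by (simp add: fst sum_distrib_right sum_subtractf case_prod_beta)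
    ultimately show "norm ((\<Sum>(l, C)\<in>I. f' l C) * a - a) < \<epsilon>"
      using s norm_triangle_ineq[of "\<Sum>i\<in>I. f' (fst i) (snd i) * a - fst (f (fst i) (snd i)) a" "fst ?s a"]
      by simp
  next
    fix a l C D assume a: "a \<in> F" and l: "l \<le> d" and C: "C \<in> P" "D \<in> P" "C \<noteq> D"
    have fst: "fst (mmult (f l C) (f l D)) = (\<lambda>x. fst (f l C) (fst (f l D) x))"
      by (auto simp: mmult_def)
    have "bounded_linear (fst (mmult (f l C) (f l D)))"
      unfolding fst by (intro bounded_linear_compose[OF bl] bl l C)
    from mnorm_bound[OF this, of a] \<eta>a[OF a orth[OF l C]]
    have "norm (fst (f l C) (fst (f l D) a)) \<le> \<epsilon> / 2" by (simp add: fst)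
    then show "norm (f' l C * f' l D * a) \<le> \<epsilon>"
      using two[OF l C(1) l C(2) FA0[OF a]] \<delta>
        norm_triangle_sub[of "f' l C * f' l D * a" "fst (f l C) (fst (f l D) a)"] by linarith
  next
    fix a l h g assume a: "a \<in> F" and l: "l \<le> d" and h: "h \<in> carrier G" and g: "g \<in> M"
    have gG: "g \<in> carrier G" "inv\<^bsub>G\<^esub> g \<in> carrier G" "g \<otimes>\<^bsub>G\<^esub> h \<in> carrier G"
      using g h MF G by (auto simp: group.inv_closed subset_iff intro: group.is_monoid monoid.m_closed)
    let ?C = "h <#\<^bsub>G\<^esub> K" and ?D = "(g \<otimes>\<^bsub>G\<^esub> h) <#\<^bsub>G\<^esub> K"
    let ?b = "\<beta> (inv\<^bsub>G\<^esub> g) a"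
    have C: "?C \<in> P" "?D \<in> P" using coset h gG by auto
    have \<beta>b: "\<beta> g ?b = a"
    proof -
      have "\<beta> g \<circ> \<beta> (inv\<^bsub>G\<^esub> g) = \<beta> (g \<otimes>\<^bsub>G\<^esub> inv\<^bsub>G\<^esub> g)"
        using act gG by (simp add: cstar_action_def)
      also have "\<dots> = id" using act G gG by (simp add: cstar_action_def group.r_inv)
      finally show ?thesis by (metis comp_apply id_apply)
    qed
    have bA0: "?b \<in> A0" using a g by (auto simp: A0_def)
    let ?c = "mdiff (maction G \<beta> g (f l ?C)) (f l ?D)"
    have fst: "fst ?c = (\<lambda>x. \<beta> g (fst (f l ?C) (\<beta> (inv\<^bsub>G\<^esub> g) x)) - fst (f l ?D) x)"
      by (auto simp: mdiff_def maction_def)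
    have "bounded_linear (fst ?c)"
      unfolding fst using l C gG by (intro bounded_linear_sub bounded_linear_compose[OF bl\<beta>]
          bounded_linear_compose[OF bl] bl bl\<beta>)
    from mnorm_bound[OF this, of a] \<eta>a[OF a equi[OF l h g]]
    have c: "norm (\<beta> g (fst (f l ?C) ?b) - fst (f l ?D) a) \<le> \<epsilon> / 2" by (simp add: fst)
    \<comment> \<open>Since \<open>\<beta> g ?b = a\<close>, the product
      \<open>\<beta> g (f' l ?C) * a\<close> is the image of \<open>f' l ?C * ?b\<close>, and the
      compression error at \<open>?b\<close> is transported without growing.\<close>
    have "norm (\<beta> g (f' l ?C * ?b - fst (f l ?C) ?b)) \<le> 2 * \<delta>"
      by (rule order_trans[OF star_automorphism_norm_le[OF aut[OF gG(1)]] one[OF l C(1) bA0]])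
    moreover have "\<beta> g (f' l ?C * ?b - fst (f l ?C) ?b) = \<beta> g (f' l ?C) * a - \<beta> g (fst (f l ?C) ?b)"
      using aut[OF gG(1)] \<beta>b
      by (simp add: linear_diff[OF bounded_linear.linear[OF bl\<beta>[OF gG(1)]]] star_automorphism_def)
    ultimately have "norm (\<beta> g (f' l ?C) * a - \<beta> g (fst (f l ?C) ?b)) \<le> 2 * \<delta>" by simp
    moreover have "norm (f' l ?D * a - fst (f l ?D) a) \<le> 2 * \<delta>" by (rule one[OF l C(2) FA0[OF a]])
    ultimately have "norm ((\<beta> g (f' l ?C) * a - \<beta> g (fst (f l ?C) ?b)) - (f' l ?D * a - fst (f l ?D) a))
        \<le> 4 * \<delta>"
      using norm_triangle_ineq4[of "\<beta> g (f' l ?C) * a - \<beta> g (fst (f l ?C) ?b)" "f' l ?D * a - fst (f l ?D) a"]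
      by linarith
    from norm_triangle_mono[OF this c]
    have "norm (\<beta> g (f' l ?C) * a - f' l ?D * a) \<le> 4 * \<delta> + \<epsilon> / 2" by (simp add: algebra_simps)
    then show "norm ((\<beta> g (f' l ?C) - f' l ?D) * a) < \<epsilon>"
      using \<delta> by (simp add: left_diff_distrib)
  next
    fix a l C assume a: "a \<in> F" and l: "l \<le> d" and C: "C \<in> P"
    have R: "norm (a * f' l C - snd (f l C) a) \<le> 2 * \<delta>"
      unfolding f'_def using a l C
      by (intro compress_mult_right pos e less_imp_le[OF re]) (auto simp: A0_def A3)
    \<comment> \<open>Up to the left and right compression errors, the commutator of
      \<open>f' l C\<close> with \<open>a\<close> is
      \<open>fst (f l C) a - snd (f l C) a\<close>.\<close>
    have "norm ((f' l C * a - fst (f l C) a) - (a * f' l C - snd (f l C) a)) \<le> 4 * \<delta>"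
      using norm_triangle_ineq4[of "f' l C * a - fst (f l C) a" "a * f' l C - snd (f l C) a"]
        one[OF l C FA0[OF a]] R by linarith
    from norm_triangle_mono[OF this mcomm_membed_norm_le[OF dc[OF l C] central[OF l C a]]]
    have "norm (f' l C * a - a * f' l C) \<le> 4 * \<delta> + \<eta>" by (simp add: algebra_simps)
    then show "norm (f' l C * a - a * f' l C) < \<epsilon>" using \<delta> \<eta> by linarith
  next
    fix a k l C D assume comm: comm and a: "a \<in> F" and kl: "k \<le> d" "l \<le> d" and CD: "C \<in> P" "D \<in> P"
    let ?c = "mcomm (f k C) (f l D)"
    have fst: "fst ?c = (\<lambda>x. fst (f k C) (fst (f l D) x) - fst (f l D) (fst (f k C) x))"
      by (auto simp: mcomm_def mdiff_def mmult_def)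
    have "bounded_linear (fst ?c)"
      unfolding fst using kl CD by (intro bounded_linear_sub bounded_linear_compose[OF bl] bl)
    from mnorm_bound[OF this, of a] \<eta>a[OF a commuting[OF comm kl(2,1) CD]]
    have c: "norm (fst (f k C) (fst (f l D) a) - fst (f l D) (fst (f k C) a)) \<le> \<epsilon> / 2"
      by (simp add: fst)
    have "norm ((f' k C * f' l D * a - fst (f k C) (fst (f l D) a))
        - (f' l D * f' k C * a - fst (f l D) (fst (f k C) a))) \<le> 8 * \<delta>"
      using norm_triangle_ineq4[of "f' k C * f' l D * a - fst (f k C) (fst (f l D) a)"
          "f' l D * f' k C * a - fst (f l D) (fst (f k C) a)"]
        two[OF kl(1) CD(1) kl(2) CD(2) FA0[OF a]] two[OF kl(2) CD(2) kl(1) CD(1) FA0[OF a]] by linarith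
    from norm_triangle_mono[OF this c]
    have "norm (f' k C * f' l D * a - f' l D * f' k C * a) \<le> 8 * \<delta> + \<epsilon> / 2" by simp
    then show "norm ((f' k C * f' l D - f' l D * f' k C) * a) < \<epsilon>"
      using \<delta> by (simp add: left_diff_distrib)
  qed
  then show "\<exists>f. rokhlin_towers comm G K \<beta> d \<epsilon> M F f" by blast
qed

theorem theorem5p8:
  fixes G :: "('g, 'm) monoid_scheme"
    and K :: "'g set"
    and \<beta> :: "'g \<Rightarrow> 'a::cstar_algebra \<Rightarrow> 'a"
    and d :: nat
  assumes "group G"
    and "countable (carrier G)"
    and "subgroup K G"
    and "finite (lcoset_space G K)"
    and "separable_cstar TYPE('a)"
    and "cstar_action G \<beta>"
  shows "(mult_rokhlin_dim_le False G K \<beta> d \<longrightarrow> rokhlin_dim_le False G K \<beta> d) \<and>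
         (mult_rokhlin_dim_le True G K \<beta> d \<longrightarrow> rokhlin_dim_le True G K \<beta> d)"
  using rokhlin_dim_le_if_mult_rokhlin_dim_le[OF assms(1,4,6)] by blast

end
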